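(* Let $\lambda$ be a ballot path ending at height $h$, let $N_D(\lambda)$ be the number of $D$ steps of $\lambda$, and let $\tilde\lambda=\lambda D^h$ (a Dyck path). Then $$P^{III}_{\lambda,\ast}=P^{\mathrm{Dyck}}_{\tilde\lambda}\cdot\prod_{i=1}^{N_D(\lambda)}(1+q^{i-1}t).$$
   Context: Paths: a path of length $N$ is a word in $\{U,D\}$ identified with the lattice path from $(0,0)$ with steps $U=(1,1)$, $D=(1,-1)$; $\lambda(x)$ is its height at $x$. A ballot path never goes below height $0$; a Dyck path is a ballot path ending at height $0$. Boxes: for integers $a,b$ with $a+b$ odd, the box centered at $(a,b)$ is the closed square with vertices $(a\pm1,b),(a,b\pm1)$. Dyck tilings: for a Dyck path $\nu$ of length $2n$, $Y(\nu)$ is the set of boxes centered at $(a,b)$ with $b-1\ge\nu(a)$, $b+1\le a$, $b+1\le 2n-a$; for a Dyck path $\mu$ weakly above $\nu$, $\nu/\mu=Y(\nu)\setminus Y(\mu)$. A Dyck tile is a nonempty set of boxes whose centers, listed left to right $c_0,\dots,c_{2k}$, satisfy $c_{i+1}-c_i\in\{(1,\pm1)\}$, none lower than $c_0$, $c_{2k}$ at the height of $c_0$. A Dyck tiling is a partition of $\nu/\mu$ into Dyck tiles; it is cover-inclusive if for every tile $\tau$, $\tau-(0,2)$ either lies entirely below $\nu$ (each translated box has its top vertex at or below $\nu$) or is contained in a single tile. $\mathrm{art}=(\#\text{boxes}+\#\text{tiles})/2$ and $P^{\mathrm{Dyck}}_\nu=\sum q^{\mathrm{art}(D)}$ over all cover-inclusive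 Dyck tilings $D$ of $\nu/\mu$, over all Dyck paths $\mu$ weakly above $\nu$. Ballot tilings: for a path $\lambda$ of length $N$, the shifted diagram $S(\lambda)$ is the set of boxes centered at $(a,b)$ with $1\le a\le N$, $b-1\ge\lambda(a)$ and $b+1\le a$; boxes with $a=N$ are anchor boxes. For a path $\mu$ of length $N$ weakly above $\lambda$, $\lambda/\mu=S(\lambda)\setminus S(\mu)$. A ballot tile of length $(2n,n')$ is a set of $2n+n'+1$ boxes whose centers listed left to right $c_0,\dots,c_{2n+n'}$ satisfy $c_{i+1}-c_i\in\{(1,\pm1)\}$, none lower than $c_0$, and $c_{2n+n'}$ exactly $n'$ higher than $c_0$ (Dyck tiles are those with $n'=0$). A ballot tiling of $\lambda/\mu$ is a partition into ballot tiles such that every tile with $n'\ge1$ has its rightmost box an anchor box; it is cover-inclusive if for every tile $\tau$, $\tau-(0,2)$ either lies entirely below $\lambda$ or is contained in a single tile. Type BIII weights: a tile of length $(2n,n')$ has $\mathrm{art}=n$ if its rightmost box is an anchor box and $\mathrm{art}=n+1$ otherwise; $\mathrm{art}(B)$ of a tiling is the sum over tiles, and $\mathrm{tiles}_2(B)$ is the number of tiles whose rightmost box is an anchor box. $P^{III}_{\lambda,\ast}=\sum q^{\mathrm{art}(B)}t^{\mathrm{tiles}_2(B)}$ over all cover-inclusive ballot tilings $B$ of $\lambda/\mu$, over all paths $\mu$ of length $N$ weakly above $\lambda$. *)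

theory Defs
  imports Main
begin

text \<open>Paths are lists of steps: True = U = (1,1), False = D = (1,-1).
  Box centers are integer points (a,b); a tile is a set of centers;
  a tiling is a set of tiles.\<close>

definition height :: "bool list \<Rightarrow> int \<Rightarrow> int" where
  "height p x = (\<Sum>s\<leftarrow>take (nat x) p. if s then 1 else -1)"

definition ballot_path :: "bool list \<Rightarrow> bool" where
  "ballot_path p \<longleftrightarrow> (\<forall>x\<in>{0..int (length p)}. 0 \<le> height p x)"

definition dyck_path :: "bool list \<Rightarrow> bool" where
  "dyck_path p \<longleftrightarrow> ballot_path p \<and> height p (int (length p)) = 0"

definition weakly_above :: "bool list \<Rightarrow> bool list \<Rightarrow> bool" where
  "weakly_above mu lam \<longleftrightarrow> length mu = length lam \<and>
     (\<forall>x\<in>{0..int (length lam)}. height lam x \<le> height mu x)"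

definition dyckY :: "bool list \<Rightarrow> (int \<times> int) set" where
  "dyckY nu = {(a, b). odd (a + b) \<and> height nu a \<le> b - 1 \<and> b + 1 \<le> a
                        \<and> b + 1 \<le> int (length nu) - a}"

definition shiftedS :: "bool list \<Rightarrow> (int \<times> int) set" where
  "shiftedS lam = {(a, b). odd (a + b) \<and> 1 \<le> a \<and> a \<le> int (length lam)
                        \<and> height lam a \<le> b - 1 \<and> b + 1 \<le> a}"

definition is_partition :: "'a set set \<Rightarrow> 'a set \<Rightarrow> bool" where
  "is_partition P R \<longleftrightarrow> \<Union>P = R \<and> (\<forall>T\<in>P. T \<noteq> {}) \<and>
     (\<forall>T\<in>P. \<forall>T'\<in>P. T \<noteq> T' \<longrightarrow> T \<inter> T' = {})"

definition ballot_chain :: "(int \<times> int) list \<Rightarrow> bool" where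
  "ballot_chain cs \<longleftrightarrow> cs \<noteq> [] \<and>
     (\<forall>i. Suc i < length cs \<longrightarrow> fst (cs ! Suc i) = fst (cs ! i) + 1 \<and>
            (snd (cs ! Suc i) = snd (cs ! i) + 1 \<or> snd (cs ! Suc i) = snd (cs ! i) - 1)) \<and>
     (\<forall>c\<in>set cs. snd (hd cs) \<le> snd c) \<and> snd (hd cs) \<le> snd (last cs)"

definition ballot_tile :: "(int \<times> int) set \<Rightarrow> bool" where
  "ballot_tile T \<longleftrightarrow> (\<exists>cs. ballot_chain cs \<and> set cs = T)"

definition dyck_tile :: "(int \<times> int) set \<Rightarrow> bool" where
  "dyck_tile T \<longleftrightarrow> (\<exists>cs. ballot_chain cs \<and> set cs = T \<and> snd (last cs) = snd (hd cs))"

text \<open>The (unique) left-to-right listing of a ballot tile.\<close>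
definition tile_list :: "(int \<times> int) set \<Rightarrow> (int \<times> int) list" where
  "tile_list T = (SOME cs. ballot_chain cs \<and> set cs = T)"

definition tile_rise :: "(int \<times> int) set \<Rightarrow> int" where
  "tile_rise T = snd (last (tile_list T)) - snd (hd (tile_list T))"

text \<open>For a tile of length (2n,n'), this is n.\<close>
definition tile_n :: "(int \<times> int) set \<Rightarrow> nat" where
  "tile_n T = nat ((int (card T) - 1 - tile_rise T) div 2)"

definition anchored :: "bool list \<Rightarrow> (int \<times> int) set \<Rightarrow> bool" where
  "anchored lam T \<longleftrightarrow> fst (last (tile_list T)) = int (length lam)"

definition shift_down :: "(int \<times> int) set \<Rightarrow> (int \<times> int) set" where
  "shift_down T = (\<lambda>(a, b). (a, b - 2)) ` T"

text \<open>Each box lies below the path: its top vertex (a,b+1) is at or below the path.\<close>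
definition below_path :: "bool list \<Rightarrow> (int \<times> int) set \<Rightarrow> bool" where
  "below_path p T \<longleftrightarrow> (\<forall>(a, b)\<in>T. b + 1 \<le> height p a)"

definition cover_inclusive :: "bool list \<Rightarrow> (int \<times> int) set set \<Rightarrow> bool" where
  "cover_inclusive p D \<longleftrightarrow>
     (\<forall>\<tau>\<in>D. below_path p (shift_down \<tau>) \<or> (\<exists>\<tau>'\<in>D. shift_down \<tau> \<subseteq> \<tau>'))"

definition dyck_tiling :: "bool list \<Rightarrow> bool list \<Rightarrow> (int \<times> int) set set \<Rightarrow> bool" where
  "dyck_tiling nu mu D \<longleftrightarrow> is_partition D (dyckY nu - dyckY mu) \<and> (\<forall>\<tau>\<in>D. dyck_tile \<tau>)"

definition ballot_tiling :: "bool list \<Rightarrow> bool list \<Rightarrow> (int \<times> int) set set \<Rightarrow> bool" where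
  "ballot_tiling lam mu B \<longleftrightarrow> is_partition B (shiftedS lam - shiftedS mu) \<and>
     (\<forall>\<tau>\<in>B. ballot_tile \<tau> \<and> (1 \<le> tile_rise \<tau> \<longrightarrow> anchored lam \<tau>))"

definition art_dyck :: "(int \<times> int) set set \<Rightarrow> nat" where
  "art_dyck D = (card (\<Union>D) + card D) div 2"

definition art3_tile :: "bool list \<Rightarrow> (int \<times> int) set \<Rightarrow> nat" where
  "art3_tile lam T = (if anchored lam T then tile_n T else tile_n T + 1)"

definition art3 :: "bool list \<Rightarrow> (int \<times> int) set set \<Rightarrow> nat" where
  "art3 lam B = (\<Sum>\<tau>\<in>B. art3_tile lam \<tau>)"

definition tiles2 :: "bool list \<Rightarrow> (int \<times> int) set set \<Rightarrow> nat" where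
  "tiles2 lam B = card {\<tau>\<in>B. anchored lam \<tau>}"

definition P_dyck :: "bool list \<Rightarrow> 'a::comm_ring_1 \<Rightarrow> 'a" where
  "P_dyck nu q = (\<Sum>(mu, D)\<in>{(mu, D). dyck_path mu \<and> weakly_above mu nu \<and>
        dyck_tiling nu mu D \<and> cover_inclusive nu D}. q ^ art_dyck D)"

definition P_III :: "bool list \<Rightarrow> 'a::comm_ring_1 \<Rightarrow> 'a \<Rightarrow> 'a" where
  "P_III lam q t = (\<Sum>(mu, B)\<in>{(mu, B). weakly_above mu lam \<and>
        ballot_tiling lam mu B \<and> cover_inclusive lam B}. q ^ art3 lam B * t ^ tiles2 lam B)"

definition num_D :: "bool list \<Rightarrow> nat" where
  "num_D p = length (filter Not p)"

end

(* A cover-inclusive tiling is organised in layers: every tile is a translate of a stretch of the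
   lower path by some odd height 2j + 1, and the tiles of layer j + 1 lie over those of layer j.
   The tiling is therefore encoded by the number K a of boxes in each column a, and the number C s
   of layers in which the columns s and s + 1 belong to the same tile.  The possible (K, C) are read
   off the path from left to right by an automaton with a stack holding C for the open up-steps, and
   the weight is q to the sum of K s over all steps s minus the sum of C s over the up-steps, times t to the number
   of boxes in the last column.

   Let a stretch of path with n up-steps and d down-steps act linearly on polynomials in t, t ^ k being
   the state K = k.  Then it maps Y k = (1 + t) (1 + q t) ... (1 + q ^ (k - 1) t) to
   p [n + k choose k] Y (d + k), with a constant p depending on the stretch only.  This follows by
   induction along the first-return decomposition from Pascal's rule.  Closing the open up-steps by
   down-steps does not change p.  Finally the Dyck sum is the ballot sum at t = 0. *)
theory Submission
  imports Defs
begin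

text \<open>Why a stack suffices: within one layer a tile crossing an up-step starts no higher than
  the foot of that step, and before the last column it can stop only at its starting height. So it
  also crosses everything up to the matching down-step, if there is one; conversely a tile crossing
  a down-step has come through the matching up-step. Hence C agrees on matched steps and does not
  decrease inwards. The weight: a tile contributes the number of its down-steps, plus 1 unless it
  reaches the last column. In column s, K s - C s tiles end, and C s tiles cross step s; a down-step
  thus adds (K s - C s) + C s = K s. The polynomials Y k: a down-step acts as f(t) -> (1 + t) f(q
  t), which sends Y k to Y (k + 1). An up-step that leaves C at its minimum sends Y k to (Y (k + 1)
  - 1) / t, the sum of q ^ j Y j over j <= k; raising C further repeats this with a smaller
  exponent, and the resulting sums telescope by Pascal's rule.\<close>

section \<open>Path sums on the polynomials Y k\<close>

text \<open>\<open>gbinom q a b\<close> is the Gaussian binomial of \<open>a + b\<close> over \<open>a\<close>; this indexing avoids the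
  out-of-range cases.\<close>
fun gbinom :: "'a::comm_ring_1 \<Rightarrow> nat \<Rightarrow> nat \<Rightarrow> 'a" where
  "gbinom q 0 b = 1"
| "gbinom q (Suc a) 0 = 1"
| "gbinom q (Suc a) (Suc b) = gbinom q a (Suc b) + q ^ Suc a * gbinom q (Suc a) b"

lemma gbinom_0_right [simp]: "gbinom q a 0 = 1"
  by (cases a) auto

text \<open>Both sides are the q-multinomial coefficient of a, b, c. Factorial quotients make no
  sense in an arbitrary commutative ring, so the three-term Pascal recursion, lowering a, b and c in
  turn, is matched on the two sides.\<close>

lemma gbinom_trinomial:
  "gbinom q a b * gbinom q (a + b) c = gbinom q a (b + c) * gbinom q b c"
proof (induction "a + b + c" arbitrary: a b c)
  case 0
  then show ?case by simp
next
  case (Suc m)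
  show ?case
  proof (cases "a = 0 \<or> b = 0 \<or> c = 0")
    case True
    then show ?thesis by auto
  next
    case False
    then obtain a' b' c' where abc: "a = Suc a'" "b = Suc b'" "c = Suc c'"
      by (metis not0_implies_Suc)
    have 1: "gbinom q a' b * gbinom q (a' + b) c = gbinom q a' (b + c) * gbinom q b c"
      using Suc.hyps(2) abc by (intro Suc.hyps(1)) simp
    have 2: "gbinom q a b' * gbinom q (a + b') c = gbinom q a (b' + c) * gbinom q b' c"
      using Suc.hyps(2) abc by (intro Suc.hyps(1)) simp
    have 3: "gbinom q a b * gbinom q (a + b) c' = gbinom q a (b + c') * gbinom q b c'"
      using Suc.hyps(2) abc by (intro Suc.hyps(1)) simp
    have p1: "gbinom q a b = gbinom q a' b + q ^ a * gbinom q a b'" using abc by simp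
    have p2: "gbinom q (a + b) c = gbinom q (a' + b) c + q ^ (a + b) * gbinom q (a + b) c'"
      using abc by simp
    have p3: "gbinom q a (b + c) = gbinom q a' (b + c) + q ^ a * gbinom q a (b' + c)"
      using abc by simp
    have p4: "gbinom q b c = gbinom q b' c + q ^ b * gbinom q b c'" using abc by simp
    have ab: "a' + b = a + b'" "b' + c = b + c'" using abc by auto
    have "gbinom q a b * gbinom q (a + b) c =
      gbinom q a' b * gbinom q (a' + b) c + q ^ a * (gbinom q a b' * gbinom q (a + b') c)
      + q ^ (a + b) * (gbinom q a b * gbinom q (a + b) c')"
      unfolding p2 by (subst distrib_left, subst p1) (simp add: ab algebra_simps)
    also have "\<dots> = gbinom q a' (b + c) * gbinom q b c + q ^ a * (gbinom q a (b' + c) * gbinom q b' c)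
      + q ^ (a + b) * (gbinom q a (b + c') * gbinom q b c')"
      by (simp only: 1 2 3)
    also have "\<dots> = gbinom q a' (b + c) * gbinom q b c
       + q ^ a * gbinom q a (b' + c) * (gbinom q b' c + q ^ b * gbinom q b c')"
      by (simp add: ab power_add algebra_simps)
    also have "\<dots> = gbinom q a (b + c) * gbinom q b c"
      unfolding p4[symmetric] p3 by (simp add: algebra_simps)
    finally show ?thesis .
  qed
qed

text \<open>\<open>yeval q k f\<close> is the linear functional \<open>t ^ i \<mapsto> f i\<close> applied to the polynomial
  \<open>(1 + t) (1 + q t) \<dots> (1 + q ^ (k - 1) t)\<close>.\<close>
primrec yeval :: "'a::comm_ring_1 \<Rightarrow> nat \<Rightarrow> (nat \<Rightarrow> 'a) \<Rightarrow> 'a" where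
  "yeval q 0 f = f 0"
| "yeval q (Suc k) f = yeval q k f + q ^ k * yeval q k (\<lambda>i. f (Suc i))"

lemma yeval_add: "yeval q k (\<lambda>i. f i + g i) = yeval q k f + yeval q k g"
  by (induction k arbitrary: f g) (simp_all add: algebra_simps)

lemma yeval_cmult: "yeval q k (\<lambda>i. c * f i) = c * yeval q k f"
  by (induction k arbitrary: f) (simp_all add: algebra_simps)

lemma yeval_power: "yeval q k (\<lambda>i. t ^ i) = (\<Prod>i<k. 1 + q ^ i * t)"
  by (induction k) (simp_all add: yeval_cmult algebra_simps)

text \<open>Splits off the factor 1 + t instead of the last one: Y (k + 1) is (1 + t) times Y k at q
  t. This is the action of a down-step.\<close>

lemma yeval_Suc': "yeval q (Suc k) f = yeval q k (\<lambda>i. q ^ i * (f i + f (Suc i)))"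
proof (induction k arbitrary: f)
  case 0
  then show ?case by simp
next
  case (Suc k)
  have "yeval q (Suc (Suc k)) f = yeval q (Suc k) f + q ^ Suc k * yeval q (Suc k) (\<lambda>i. f (Suc i))"
    by simp
  also have "\<dots> = yeval q k (\<lambda>i. q ^ i * (f i + f (Suc i)))
      + q ^ Suc k * yeval q k (\<lambda>i. q ^ i * (f (Suc i) + f (Suc (Suc i))))"
    by (simp only: Suc)
  also have "q ^ Suc k * yeval q k (\<lambda>i. q ^ i * (f (Suc i) + f (Suc (Suc i))))
    = q ^ k * yeval q k (\<lambda>i. q * (q ^ i * (f (Suc i) + f (Suc (Suc i)))))"
    by (simp only: yeval_cmult power_Suc ac_simps)
  finally show ?case by (simp add: ac_simps)
qed

abbreviation shift0 :: "(nat \<Rightarrow> 'a::zero) \<Rightarrow> nat \<Rightarrow> 'a" where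
  "shift0 f i \<equiv> (case i of 0 \<Rightarrow> 0 | Suc i' \<Rightarrow> f i')"

text \<open>Dually, \<open>shift0\<close> drops the constant term and divides by t, and (Y k - 1) /
  t is a telescoping sum because Y (j + 1) - Y j = q ^ j t Y j.\<close>

lemma yeval_shift0: "yeval q k (shift0 f) = (\<Sum>j<k. q ^ j * yeval q j f)"
  by (induction k) simp_all

lemma yeval_up: "yeval q k (\<lambda>i. q ^ i * (f i + shift0 f i)) = (\<Sum>j\<le>k. q ^ j * yeval q j f)"
  using yeval_Suc'[of q k "shift0 f"]
  by (simp add: add.commute lessThan_Suc_atMost[symmetric] yeval_shift0)

section \<open>The stack automaton and its action on Y k\<close>

definition up_choices :: "nat \<Rightarrow> nat \<Rightarrow> (nat \<times> nat) set" where
  "up_choices k c = {(k', c'). (k' = k \<or> Suc k' = k) \<and> c \<le> c' \<and> c' \<le> k'}"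

text \<open>The terminal value \<open>\<Phi>\<close> is arbitrary so that the sum over a suffix can
  serve as the terminal value of a prefix.\<close>

primrec wsum ::
  "'a::comm_ring_1 \<Rightarrow> (nat \<Rightarrow> nat list \<Rightarrow> 'a) \<Rightarrow> bool list \<Rightarrow> nat \<Rightarrow> nat list \<Rightarrow> 'a" where
  "wsum q \<Phi> [] k st = \<Phi> k st"
| "wsum q \<Phi> (s # w) k st =
    (if s then (\<Sum>(k', c)\<in>up_choices k (hd st). q ^ (k - c) * wsum q \<Phi> w k' (c # st))
     else q ^ k * (wsum q \<Phi> w k (tl st) + wsum q \<Phi> w (Suc k) (tl st)))"

lemma wsum_append: "wsum q \<Phi> (v @ w) k st = wsum q (wsum q \<Phi> w) v k st"
  by (induction v arbitrary: k st) simp_all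

text \<open>The numbers count up-steps and down-steps, the last argument is the constant of the
  stretch. A first up-step without a matching down-step falls under \<open>decomp_up\<close>. The
  binomial in \<open>decomp_chord\<close> is what \<open>gbinom_trinomial\<close> leaves when the
  binomials of the chord and of the rest are merged; it involves up-steps only.\<close>

inductive decomp :: "'a::comm_ring_1 \<Rightarrow> bool list \<Rightarrow> nat \<Rightarrow> nat \<Rightarrow> 'a \<Rightarrow> bool" for q where
  decomp_Nil: "decomp q [] 0 0 1"
| decomp_up: "decomp q w n d p \<Longrightarrow> decomp q (True # w) (Suc n) d p"
| decomp_chord: "\<lbrakk>decomp q v n n p; decomp q w m e r\<rbrakk> \<Longrightarrow>
    decomp q (True # v @ False # w) (Suc n + m) (Suc n + e) (p * r * gbinom q (Suc n) m)"

lemma finite_up_choices: "finite (up_choices k c)"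
  by (rule finite_subset[of _ "{..k} \<times> {..k}"]) (auto simp: up_choices_def)

text \<open>The choices with c' = c give the first summand, with the two possible K'. Those with c'
  > c are the choices over the base \<open>Suc c\<close>, where the same K exceeds the base by one
  less; hence the shift.\<close>

lemma sum_up_choices:
  fixes G :: "nat \<Rightarrow> nat \<Rightarrow> 'a::comm_ring_1"
  shows "(\<Sum>(k', c')\<in>up_choices (c + i) c. q ^ (c + i - c') * G c' k') =
    q ^ i * (G c (c + i) + shift0 (\<lambda>i. G c (c + i)) i) +
    shift0 (\<lambda>i. \<Sum>(k', c')\<in>up_choices (Suc c + i) (Suc c). q ^ (Suc c + i - c') * G c' k') i"
proof (cases i)
  case 0
  have "up_choices c c = {(c, c)}" by (auto simp: up_choices_def)
  then show ?thesis using 0 by simp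
next
  case (Suc m)
  have e: "up_choices (c + i) c =
      {(c + i, c), (c + m, c)} \<union> up_choices (Suc c + m) (Suc c)"
    using Suc by (auto simp: up_choices_def)
  have "{(c + i, c), (c + m, c)} \<inter> up_choices (Suc c + m) (Suc c) = {}"
    by (auto simp: up_choices_def)
  then have "(\<Sum>(k', c')\<in>up_choices (c + i) c. q ^ (c + i - c') * G c' k') =
     (\<Sum>(k', c')\<in>{(c + i, c), (c + m, c)}. q ^ (c + i - c') * G c' k') +
     (\<Sum>(k', c')\<in>up_choices (Suc c + m) (Suc c). q ^ (c + i - c') * G c' k')"
    unfolding e by (intro sum.union_disjoint) (auto simp: finite_up_choices)
  then show ?thesis using Suc by (simp add: algebra_simps)
qed

text \<open>Adds one up-step in front of a stretch whose action is known for every base c. The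
  induction on k absorbs the choices with larger C, since they only involve Y j for j < k.\<close>

lemma yeval_up_choices:
  fixes G :: "nat \<Rightarrow> nat \<Rightarrow> 'a::comm_ring_1"
  assumes IH: "\<And>c k. yeval q k (\<lambda>i. G c (c + i)) =
      q ^ (c * d) * p * gbinom q k n * yeval q (d + k) (\<lambda>i. \<phi> (c + i))"
  shows "yeval q k (\<lambda>i. \<Sum>(k', c')\<in>up_choices (c + i) c. q ^ (c + i - c') * G c' k') =
    q ^ (c * d) * p * gbinom q k (Suc n) * yeval q (d + k) (\<lambda>i. \<phi> (c + i))"
proof (induction k arbitrary: c rule: less_induct)
  case (less k)
  define R where "R c i = (\<Sum>(k', c')\<in>up_choices (c + i) c. q ^ (c + i - c') * G c' k')" for c i
  define y where "y c k = yeval q (d + k) (\<lambda>i. \<phi> (c + i))" for c k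
  have y_Suc: "q ^ (d + j) * y (Suc c) j = y c (Suc j) - y c j" for j
    by (simp add: y_def)
  have R: "R c = (\<lambda>i. q ^ i * (G c (c + i) + shift0 (\<lambda>i. G c (c + i)) i) + shift0 (R (Suc c)) i)"
    unfolding R_def by (rule ext) (rule sum_up_choices)
  \<comment> \<open>The coefficient of each y c j with 0 < j < k vanishes by Pascal's rule; only the
    one at j = k survives.\<close>
  have telescope: "(\<Sum>j\<le>k. q ^ j * gbinom q j n * y c j) +
      (\<Sum>j<k. gbinom q j (Suc n) * (y c (Suc j) - y c j)) = gbinom q k (Suc n) * y c k" for k
    by (induction k) (simp_all add: algebra_simps)
  have "yeval q k (R c) = (\<Sum>j\<le>k. q ^ j * yeval q j (\<lambda>i. G c (c + i))) +
      (\<Sum>j<k. q ^ j * yeval q j (R (Suc c)))"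
    by (subst R) (simp only: yeval_add yeval_up yeval_shift0)
  also have "(\<Sum>j<k. q ^ j * yeval q j (R (Suc c))) =
     (\<Sum>j<k. q ^ (c * d) * p * (gbinom q j (Suc n) * (y c (Suc j) - y c j)))"
  proof (rule sum.cong[OF refl])
    fix j assume "j \<in> {..<k}"
    then have "yeval q j (R (Suc c)) = q ^ (Suc c * d) * p * gbinom q j (Suc n) * y (Suc c) j"
      unfolding R_def y_def by (intro less.IH) simp
    then have "q ^ j * yeval q j (R (Suc c)) =
        q ^ (c * d) * p * (gbinom q j (Suc n) * (q ^ (d + j) * y (Suc c) j))"
      by (simp add: power_add ac_simps)
    then show "q ^ j * yeval q j (R (Suc c)) =
        q ^ (c * d) * p * (gbinom q j (Suc n) * (y c (Suc j) - y c j))"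
      by (simp only: y_Suc)
  qed
  also have "(\<Sum>j\<le>k. q ^ j * yeval q j (\<lambda>i. G c (c + i))) =
      (\<Sum>j\<le>k. q ^ (c * d) * p * (q ^ j * gbinom q j n * y c j))"
    by (intro sum.cong refl) (simp add: IH y_def mult_ac)
  also have "(\<Sum>j\<le>k. q ^ (c * d) * p * (q ^ j * gbinom q j n * y c j)) +
     (\<Sum>j<k. q ^ (c * d) * p * (gbinom q j (Suc n) * (y c (Suc j) - y c j))) =
     q ^ (c * d) * p * (gbinom q k (Suc n) * y c k)"
    by (simp only: telescope sum_distrib_left[symmetric] distrib_left[symmetric])
  finally show ?case by (simp add: R_def y_def ac_simps)
qed

text \<open>Here c is the stack entry below the stretch. K never drops below c, so the polynomial
  variable records i = K - c. The weights of up-steps depend on K - C only, while each of the d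
  down-steps gains q ^ c from the offset: hence q ^ (c * d). The terminal value may not look at the
  n - d entries left on top of c.\<close>

lemma decomp_yeval_wsum:
  assumes "decomp q w n d p" "d \<le> n \<Longrightarrow> \<forall>k st'. length st' = n - d \<longrightarrow> \<Phi> k (st' @ c # st) = \<phi> k"
  shows "d \<le> n \<and> yeval q k (\<lambda>i. wsum q \<Phi> w (c + i) (c # st)) =
    q ^ (c * d) * p * gbinom q k n * yeval q (d + k) (\<lambda>i. \<phi> (c + i))"
  using assms
proof (induction arbitrary: k c st \<Phi> \<phi> rule: decomp.induct)
  case decomp_Nil
  then show ?case by simp
next
  case (decomp_up w n d p)
  \<comment> \<open>The zero terminal value meets the premise trivially, which releases the
    inequality from the induction hypothesis.\<close>
  have dn: "d \<le> n" using decomp_up.IH[of "\<lambda>_ _. 0" _ _ "\<lambda>_. 0"] by simp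
  have "\<forall>k st'. length st' = n - d \<longrightarrow> \<Phi> k (st' @ c' # c # st) = \<phi> k" for c'
  proof (intro allI impI)
    fix k and st' :: "nat list"
    assume "length st' = n - d"
    then show "\<Phi> k (st' @ c' # c # st) = \<phi> k"
      using decomp_up.prems dn by (metis Suc_diff_le append.assoc append_Cons append_Nil
          le_Suc_eq length_append_singleton)
  qed
  then have "yeval q k (\<lambda>i. wsum q \<Phi> w (c' + i) (c' # c # st)) =
    q ^ (c' * d) * p * gbinom q k n * yeval q (d + k) (\<lambda>i. \<phi> (c' + i))" for k c'
    using decomp_up.IH[of \<Phi> c' "c # st" \<phi> k] by blast
  from yeval_up_choices[OF this]
  show ?case using dn by simp
next
  case (decomp_chord v n p w m e r)
  have em: "e \<le> m" using decomp_chord.IH(2)[of "\<lambda>_ _. 0" _ _ "\<lambda>_. 0"] by simp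
  \<comment> \<open>Since v is balanced, the down-step after it pops exactly the entry of the
    leading up-step. The rest starts on the stack \<open>c # st\<close> again, so its value depends
    on K alone.\<close>
  define \<psi> where "\<psi> k = wsum q \<Phi> w k (c # st)" for k
  have w: "yeval q k (\<lambda>i. \<psi> (c + i)) =
      q ^ (c * e) * r * gbinom q k m * yeval q (e + k) (\<lambda>i. \<phi> (c + i))" for k
    unfolding \<psi>_def using decomp_chord.prems em decomp_chord.IH(2)[of \<Phi> c st \<phi> k] by simp
  have v: "yeval q k (\<lambda>i. wsum q (wsum q \<Phi> (False # w)) v (c' + i) (c' # c # st)) =
    q ^ (c' * n) * p * gbinom q k n * yeval q (n + k) (\<lambda>i. q ^ (c' + i) * (\<psi> (c' + i) + \<psi> (Suc (c' + i))))"
    for k c'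
  proof -
    have "\<forall>k st'. length st' = n - n \<longrightarrow>
        wsum q \<Phi> (False # w) k (st' @ c' # c # st) = q ^ k * (\<psi> k + \<psi> (Suc k))"
      by (simp add: \<psi>_def)
    from decomp_chord.IH(1)[of "wsum q \<Phi> (False # w)" c' "c # st"
        "\<lambda>k. q ^ k * (\<psi> k + \<psi> (Suc k))", OF this]
    show ?thesis by blast
  qed
  have "yeval q k (\<lambda>i. wsum q \<Phi> (True # v @ False # w) (c + i) (c # st)) =
    q ^ (c * n) * p * gbinom q k (Suc n) * yeval q (n + k) (\<lambda>i. q ^ (c + i) * (\<psi> (c + i) + \<psi> (Suc (c + i))))"
    using yeval_up_choices[where G="\<lambda>c' k'. wsum q (wsum q \<Phi> (False # w)) v k' (c' # c # st)"
       and \<phi>="\<lambda>k. q ^ k * (\<psi> k + \<psi> (Suc k))", OF v]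
    by (simp add: wsum_append)
  also have "yeval q (n + k) (\<lambda>i. q ^ (c + i) * (\<psi> (c + i) + \<psi> (Suc (c + i)))) =
      q ^ c * yeval q (Suc n + k) (\<lambda>i. \<psi> (c + i))"
    using yeval_Suc'[of q "n + k" "\<lambda>i. \<psi> (c + i)"]
    by (simp add: power_add mult.assoc yeval_cmult del: yeval.simps)
  also have "yeval q (Suc n + k) (\<lambda>i. \<psi> (c + i)) =
      q ^ (c * e) * r * gbinom q (Suc n + k) m * yeval q (e + (Suc n + k)) (\<lambda>i. \<phi> (c + i))"
    by (rule w)
  finally have "yeval q k (\<lambda>i. wsum q \<Phi> (True # v @ False # w) (c + i) (c # st)) =
     q ^ (c * (Suc n + e)) * p * r * (gbinom q k (Suc n) * gbinom q (k + Suc n) m) *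
     yeval q (Suc n + e + k) (\<lambda>i. \<phi> (c + i))"
    by (simp add: power_add ac_simps distrib_left del: gbinom.simps)
  \<comment> \<open>The trinomial identity isolates \<open>gbinom q (Suc n) m\<close>, which is free
    of k and joins the constant.\<close>
  then show ?case unfolding gbinom_trinomial using em by (simp add: ac_simps)
qed

lemma decomp_le: "decomp q w n d p \<Longrightarrow> d \<le> n"
  by (induction rule: decomp.induct) auto

text \<open>Closing turns each unmatched up-step into a chord with empty rest, whose extra factor is
  \<open>gbinom q (Suc n) 0\<close>, that is 1.\<close>

lemma decomp_close:
  "decomp q w n d p \<Longrightarrow> decomp q (w @ replicate (n - d) False) n n p"
proof (induction rule: decomp.induct)
  case decomp_Nil
  then show ?case by (simp add: decomp.decomp_Nil)
next
  case (decomp_up w n d p)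
  have "decomp q (True # (w @ replicate (n - d) False) @ False # []) (Suc n + 0) (Suc n + 0)
      (p * 1 * gbinom q (Suc n) 0)"
    by (intro decomp.intros decomp_up)
  then show ?case using decomp_le[OF decomp_up(1)]
    by (simp add: Suc_diff_le replicate_append_same)
next
  case (decomp_chord v n p w m e r)
  then show ?case
    using decomp.decomp_chord[OF decomp_chord(1) decomp_chord.IH(2)] by simp
qed

lemma decomp_counts: "decomp q w n d p \<Longrightarrow> num_D w = d \<and> length w = n + d"
  by (induction rule: decomp.induct) (auto simp: num_D_def)

lemma decomp_wsum:
  assumes "decomp q w n d p"
  shows "wsum q (\<lambda>k _. t ^ k) w 0 [0] = p * (\<Prod>i=1..d. 1 + q ^ (i - 1) * t)"
proof -
  have "wsum q (\<lambda>k _. t ^ k) w 0 [0] = p * (\<Prod>i<d. 1 + q ^ i * t)"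
    using decomp_yeval_wsum[OF assms, of "\<lambda>k _. t ^ k" 0 "[]" "\<lambda>k. t ^ k" 0]
    by (simp add: yeval_power)
  also have "(\<Prod>i<d. 1 + q ^ i * t) = (\<Prod>i=1..d. 1 + q ^ (i - 1) * t)"
    by (rule prod.reindex_bij_witness[of _ "\<lambda>i. i - 1" Suc]) auto
  finally show ?thesis .
qed

section \<open>Ballot paths and configurations\<close>

definition ht :: "bool list \<Rightarrow> nat \<Rightarrow> int" where
  "ht p s = height p (int s)"

lemma ht_0 [simp]: "ht p 0 = 0"
  by (simp add: ht_def height_def)

lemma ht_Suc: "s < length p \<Longrightarrow> ht p (Suc s) = ht p s + (if p ! s then 1 else -1)"
  by (simp add: ht_def height_def take_Suc_conv_app_nth nat_add_distrib)

lemma ht_Cons: "ht (x # p) (Suc s) = (if x then 1 else -1) + ht p s"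
  by (simp add: ht_def height_def nat_add_distrib)

lemma ht_append: "s \<ge> length v \<Longrightarrow> ht (v @ w) s = ht v (length v) + ht w (s - length v)"
  by (simp add: ht_def height_def flip: of_nat_diff)

lemma ht_append1: "s \<le> length v \<Longrightarrow> ht (v @ w) s = ht v s"
  by (simp add: ht_def height_def)

lemma ht_length: "ht p (length p) = int (length p) - 2 * int (num_D p)"
  by (induction p) (auto simp: ht_Cons num_D_def)

lemma even_ht: "s \<le> length p \<Longrightarrow> even (ht p s + int s)"
proof (induction s)
  case (Suc s)
  then show ?case by (auto simp: ht_Suc)
qed simp

lemma ht_le: "s \<le> length p \<Longrightarrow> ht p s \<le> int s"
proof (induction s)
  case (Suc s)
  then show ?case by (auto simp: ht_Suc)
qed simp

lemma ballot_path_iff: "ballot_path p \<longleftrightarrow> (\<forall>s\<le>length p. 0 \<le> ht p s)"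
  unfolding ballot_path_def ht_def
  by (metis atLeastAtMost_iff nonneg_int_cases of_nat_0_le_iff of_nat_le_iff)

text \<open>First-return decomposition: either the first up-step is never matched, or the first
  descent of the remaining path below 0 is its matching down-step.\<close>

lemma ballot_decomp:
  assumes "ballot_path w"
  shows "\<exists>n d p. decomp q w n d p"
  using assms
proof (induction "length w" arbitrary: w rule: less_induct)
  case less
  show ?case
  proof (cases w)
    case Nil
    then show ?thesis using decomp.decomp_Nil by blast
  next
    case (Cons x u)
    have h: "s \<le> length u \<Longrightarrow> 0 \<le> (if x then 1 else -1) + ht u s" for s
      using less.prems[unfolded ballot_path_iff, rule_format, of "Suc s"] Cons
      by (simp add: ht_Cons)
    from h[of 0] have x by (cases x) simp_all
    show ?thesis
    proof (cases "ballot_path u")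
      case True
      with less.hyps[of u] obtain n d p where "decomp q u n d p" using Cons by auto
      then show ?thesis using Cons \<open>x\<close> decomp.decomp_up[of q u n d p] by auto
    next
      case False
      then have ex: "\<exists>s. s \<le> length u \<and> ht u s < 0" by (auto simp: ballot_path_iff not_le)
      define s where "s = (LEAST s. s \<le> length u \<and> ht u s < 0)"
      have s: "s \<le> length u" "ht u s < 0" using LeastI_ex[OF ex] by (auto simp: s_def)
      have below: "0 \<le> ht u y" if "y < s" for y
        using not_less_Least[of y "\<lambda>s. s \<le> length u \<and> ht u s < 0"] that s by (auto simp: s_def)
      from s(2) obtain m where m: "s = Suc m" by (cases s) auto
      with s below[of m] have um: "\<not> u ! m" "ht u m = 0"
        using ht_Suc[of m u] by (auto split: if_splits)
      define v w' where "v = take m u" and "w' = drop s u"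
      have u: "u = v @ False # w'" using id_take_nth_drop[of m u] um(1) s m by (simp add: v_def w'_def)
      have lv: "length v = m" using s m by (simp add: v_def)
      have v: "ballot_path v"
        unfolding ballot_path_iff lv using below m ht_append1[of _ v "False # w'"] u lv by simp
      have hv: "ht v (length v) = 0" using um(2) u lv ht_append1[of m v "False # w'"] by simp
      have w': "ballot_path w'"
        unfolding ballot_path_iff
      proof (intro allI impI)
        fix y assume y: "y \<le> length w'"
        have "ht u (Suc m + y) = ht w' y - 1"
          using u lv hv ht_append[of v "Suc m + y" "False # w'"] ht_Cons[of False w' y] by simp
        moreover have "0 \<le> 1 + ht u (Suc m + y)" using h[of "Suc m + y"] \<open>x\<close> y lv u by simp
        ultimately show "0 \<le> ht w' y" by simp
      qed
      from less.hyps[of v] v u Cons obtain n d p where dv: "decomp q v n d p" by auto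
      from less.hyps[of w'] w' u Cons obtain m e r where dw: "decomp q w' m e r" by auto
      have "n = d" using decomp_counts[OF dv] hv ht_length[of v] by simp
      then show ?thesis using decomp.decomp_chord[OF _ dw, of v n p] dv Cons u \<open>x\<close> by auto
    qed
  qed
qed

section \<open>Automaton runs as lists of pairs (K (s + 1), C s)\<close>

fun config :: "bool list \<Rightarrow> nat \<Rightarrow> nat list \<Rightarrow> (nat \<times> nat) list \<Rightarrow> bool" where
  "config [] k st xs \<longleftrightarrow> xs = []"
| "config (s # w) k st [] \<longleftrightarrow> False"
| "config (s # w) k st ((k', c) # xs) \<longleftrightarrow>
    (if s then (k', c) \<in> up_choices k (hd st) \<and> config w k' (c # st) xs
     else (k' = k \<or> k' = Suc k) \<and> c = hd st \<and> config w k' (tl st) xs)"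

fun config_weight :: "'a::comm_ring_1 \<Rightarrow> 'a \<Rightarrow> bool list \<Rightarrow> nat \<Rightarrow> (nat \<times> nat) list \<Rightarrow> 'a" where
  "config_weight q t (s # w) k ((k', c) # xs) =
     q ^ (if s then k - c else k) * config_weight q t w k' xs"
| "config_weight q t _ k _ = t ^ k"

lemma config_True: "{xs. config (True # w) k st xs} =
    (\<lambda>((k', c), xs). (k', c) # xs) `
      (SIGMA p:up_choices k (hd st). {xs. config w (fst p) (snd p # st) xs})"
proof (rule set_eqI)
  fix xs :: "(nat \<times> nat) list"
  show "xs \<in> {xs. config (True # w) k st xs} \<longleftrightarrow> xs \<in> (\<lambda>((k', c), xs). (k', c) # xs) `
      (SIGMA p:up_choices k (hd st). {xs. config w (fst p) (snd p # st) xs})"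
    by (cases xs) (auto simp: image_iff)
qed

lemma config_False: "{xs. config (False # w) k st xs} =
    (\<lambda>xs. (k, hd st) # xs) ` {xs. config w k (tl st) xs} \<union>
    (\<lambda>xs. (Suc k, hd st) # xs) ` {xs. config w (Suc k) (tl st) xs}"
proof (rule set_eqI)
  fix xs :: "(nat \<times> nat) list"
  show "xs \<in> {xs. config (False # w) k st xs} \<longleftrightarrow> xs \<in>
    (\<lambda>xs. (k, hd st) # xs) ` {xs. config w k (tl st) xs} \<union>
    (\<lambda>xs. (Suc k, hd st) # xs) ` {xs. config w (Suc k) (tl st) xs}"
    by (cases xs) auto
qed

lemma finite_config: "finite {xs. config w k st xs}"
proof (induction w arbitrary: k st)
  case Nil
  then show ?case by simp
next
  case (Cons s w)
  then show ?case
    by (cases s) (auto simp only: config_True config_False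
        intro!: finite_imageI finite_SigmaI finite_up_choices)
qed

lemma sum_config: "(\<Sum>xs | config w k st xs. config_weight q t w k xs) = wsum q (\<lambda>k _. t ^ k) w k st"
proof (induction w arbitrary: k st)
  case Nil
  then show ?case by simp
next
  case (Cons s w)
  show ?case
  proof (cases s)
    case True
    have inj: "inj_on (\<lambda>((k', c), xs). (k', c) # xs) A" for A :: "((nat \<times> nat) \<times> (nat \<times> nat) list) set"
      by (auto simp: inj_on_def)
    have "(\<Sum>xs | config (True # w) k st xs. config_weight q t (True # w) k xs) =
       (\<Sum>(p, xs)\<in>(SIGMA p:up_choices k (hd st). {xs. config w (fst p) (snd p # st) xs}).
          q ^ (k - snd p) * config_weight q t w (fst p) xs)"
      unfolding config_True by (subst sum.reindex[OF inj]) (auto intro!: sum.cong)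
    also have "\<dots> = (\<Sum>p\<in>up_choices k (hd st). \<Sum>xs | config w (fst p) (snd p # st) xs.
          q ^ (k - snd p) * config_weight q t w (fst p) xs)"
      by (subst sum.Sigma[symmetric]) (auto simp: finite_up_choices finite_config)
    also have "\<dots> = wsum q (\<lambda>k _. t ^ k) (True # w) k st"
      by (simp add: sum_distrib_left[symmetric] Cons case_prod_beta)
    finally show ?thesis using True by simp
  next
    case False
    have inj: "inj_on (\<lambda>xs. p # xs) A" for A :: "(nat \<times> nat) list set" and p
      by (auto simp: inj_on_def)
    have "(\<Sum>xs | config (False # w) k st xs. config_weight q t (False # w) k xs) =
        (\<Sum>xs | config w k (tl st) xs. q ^ k * config_weight q t w k xs) +
        (\<Sum>xs | config w (Suc k) (tl st) xs. q ^ k * config_weight q t w (Suc k) xs)"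
      unfolding config_False
      by (subst sum.union_disjoint) (auto simp: finite_config sum.reindex[OF inj])
    then show ?thesis using False
      by (simp add: sum_distrib_left[symmetric] Cons algebra_simps)
  qed
qed

section \<open>Runs of connected columns, and the equivalence of layer conditions with stack
  moves\<close>

primrec run_start :: "(nat \<Rightarrow> nat) \<Rightarrow> nat \<Rightarrow> nat \<Rightarrow> nat" where
  "run_start C j 0 = 0"
| "run_start C j (Suc s) = (if j < C s then run_start C j s else Suc s)"

text \<open>The last two clauses are the tile shape: a run never goes below its start, and a run
  stopping at column s is back at its starting height. As s stays below the length of the path, runs
  reaching the last column may end higher; these are the anchored tiles.\<close>

definition layer_step :: "bool list \<Rightarrow> (nat \<Rightarrow> nat) \<Rightarrow> (nat \<Rightarrow> nat) \<Rightarrow> nat \<Rightarrow> bool" where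
  "layer_step lam K C s \<longleftrightarrow>
    (if lam ! s then K (Suc s) = K s \<or> Suc (K (Suc s)) = K s else K (Suc s) = K s \<or> K (Suc s) = Suc (K s)) \<and>
    C s \<le> K s \<and> C s \<le> K (Suc s) \<and>
    (\<forall>j. ht lam (run_start C j (Suc s)) \<le> ht lam (Suc s)) \<and>
    (\<forall>j\<ge>C s. ht lam s = ht lam (run_start C j s))"

definition layering :: "bool list \<Rightarrow> (nat \<Rightarrow> nat) \<Rightarrow> (nat \<Rightarrow> nat) \<Rightarrow> bool" where
  "layering lam K C \<longleftrightarrow> K 0 = 0 \<and> (\<forall>s<length lam. layer_step lam K C s)"

text \<open>The bottom 0 is a sentinel that puts no constraint on C; on a ballot path it is never
  popped.\<close>

primrec open_stack :: "bool list \<Rightarrow> (nat \<Rightarrow> nat) \<Rightarrow> nat \<Rightarrow> nat list" where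
  "open_stack lam C 0 = [0]"
| "open_stack lam C (Suc s) = (if lam ! s then C s # open_stack lam C s else tl (open_stack lam C s))"

definition config_step :: "bool list \<Rightarrow> (nat \<Rightarrow> nat) \<Rightarrow> (nat \<Rightarrow> nat) \<Rightarrow> nat \<Rightarrow> bool" where
  "config_step lam K C s \<longleftrightarrow>
    (if lam ! s then (K (Suc s), C s) \<in> up_choices (K s) (hd (open_stack lam C s))
     else (K (Suc s) = K s \<or> K (Suc s) = Suc (K s)) \<and> C s = hd (open_stack lam C s))"

definition encode :: "nat \<Rightarrow> (nat \<Rightarrow> nat) \<Rightarrow> (nat \<Rightarrow> nat) \<Rightarrow> (nat \<times> nat) list" where
  "encode n K C = map (\<lambda>i. (K (Suc i), C i)) [0..<n]"

lemma config_encode: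
  "config lam (K 0) [0] (encode (length lam) K C) \<longleftrightarrow> (\<forall>s<length lam. config_step lam K C s)"
proof -
  have "config (drop m lam) (K m) (open_stack lam C m) (map (\<lambda>i. (K (Suc i), C i)) [m..<length lam])
    \<longleftrightarrow> (\<forall>s. m \<le> s \<and> s < length lam \<longrightarrow> config_step lam K C s)" if "m \<le> length lam" for m
    using that
  proof (induction rule: inc_induct)
    case base
    then show ?case by auto
  next
    case (step m)
    have "(\<forall>s. m \<le> s \<and> s < length lam \<longrightarrow> config_step lam K C s) \<longleftrightarrow>
        config_step lam K C m \<and> (\<forall>s. Suc m \<le> s \<and> s < length lam \<longrightarrow> config_step lam K C s)"
      using step(2) by (metis Suc_le_eq le_less)
    then show ?case using step
      by (auto simp: Cons_nth_drop_Suc[symmetric] upt_conv_Cons config_step_def split: if_splits)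
  qed
  from this[of 0] show ?thesis by (simp add: encode_def)
qed

lemma config_weight_encode:
  "config_weight q t lam (K 0) (encode (length lam) K C) =
    q ^ (\<Sum>s<length lam. if lam ! s then K s - C s else K s) * t ^ K (length lam)"
proof -
  have "config_weight q t (drop m lam) (K m) (map (\<lambda>i. (K (Suc i), C i)) [m..<length lam]) =
    q ^ (\<Sum>s=m..<length lam. if lam ! s then K s - C s else K s) * t ^ K (length lam)"
    if "m \<le> length lam" for m
    using that
  proof (induction rule: inc_induct)
    case base
    then show ?case by simp
  next
    case (step m)
    then show ?case
      by (simp add: Cons_nth_drop_Suc[symmetric] upt_conv_Cons sum.atLeast_Suc_lessThan power_add)
  qed
  from this[of 0] show ?thesis by (simp add: encode_def atLeast0LessThan)
qed

lemma config_length: "config w k st xs \<Longrightarrow> length xs = length w"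
  by (induction w k st xs rule: config.induct) (auto split: if_splits)

text \<open>In layer \<open>j\<close>, the open connected steps are exactly the stack entries exceeding \<open>j\<close>, and
  they form the top of the stack; their number is the height above the start of the current run.\<close>
definition stack_inv :: "bool list \<Rightarrow> (nat \<Rightarrow> nat) \<Rightarrow> (nat \<Rightarrow> nat) \<Rightarrow> nat \<Rightarrow> bool" where
  "stack_inv lam K C s \<longleftrightarrow>
    (\<forall>j. int (length (filter ((<) j) (open_stack lam C s))) = ht lam s - ht lam (run_start C j s)) \<and>
    sorted_wrt (\<ge>) (open_stack lam C s) \<and> int (length (open_stack lam C s)) = ht lam s + 1 \<and>
    (\<forall>c\<in>set (open_stack lam C s). c \<le> K s)"

lemma stack_inv_0: "stack_inv lam K C 0"
  by (simp add: stack_inv_def)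

lemma filter_less_pos:
  assumes "sorted_wrt (\<ge>) st" "st \<noteq> []"
  shows "(j::nat) < hd st \<longleftrightarrow> filter ((<) j) st \<noteq> []"
  using assms by (cases st) (auto simp: filter_empty_conv)

context
  fixes lam :: "bool list" and K C :: "nat \<Rightarrow> nat" and s :: nat
  assumes ballot: "ballot_path lam" and s: "s < length lam" and inv: "stack_inv lam K C s"
begin

lemma stack_nonempty: "open_stack lam C s \<noteq> []"
proof
  assume "open_stack lam C s = []"
  with inv have "ht lam s + 1 = 0" by (simp add: stack_inv_def)
  moreover have "0 \<le> ht lam s" using ballot s by (simp add: ballot_path_iff)
  ultimately show False by simp
qed

text \<open>The stack is sorted, so its top exceeds j as soon as any entry does. This translates
  stack comparisons into heights.\<close>

lemma hd_stack_iff: "j < hd (open_stack lam C s) \<longleftrightarrow> ht lam (run_start C j s) < ht lam s"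
proof -
  have "j < hd (open_stack lam C s) \<longleftrightarrow> filter ((<) j) (open_stack lam C s) \<noteq> []"
    using filter_less_pos[OF _ stack_nonempty] inv by (simp add: stack_inv_def)
  also have "\<dots> \<longleftrightarrow> 0 < int (length (filter ((<) j) (open_stack lam C s)))"
    by simp
  also have "\<dots> \<longleftrightarrow> ht lam (run_start C j s) < ht lam s"
    using inv unfolding stack_inv_def by simp
  finally show ?thesis .
qed

lemma run_start_ht_le: "ht lam (run_start C j s) \<le> ht lam s"
  using inv unfolding stack_inv_def by (smt (verit) of_nat_0_le_iff)

text \<open>Layers j < C s continue and gain or lose one entry along with the height. In the other
  layers a new run starts, and no entry exceeds j because C s bounds the whole stack: it is pushed
  on top of smaller entries, or is itself the old top.\<close>

lemma config_step_inv:
  assumes "config_step lam K C s"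
  shows "stack_inv lam K C (Suc s)"
proof (cases "lam ! s")
  case True
  have a: "hd (open_stack lam C s) \<le> C s" "C s \<le> K (Suc s)"
    using assms True by (auto simp: config_step_def up_choices_def)
  have sorted: "sorted_wrt (\<ge>) (open_stack lam C s)" using inv by (simp add: stack_inv_def)
  then have "\<forall>c\<in>set (open_stack lam C s). c \<le> hd (open_stack lam C s)"
    by (cases "open_stack lam C s") auto
  with a(1) have le: "\<forall>c\<in>set (open_stack lam C s). c \<le> C s" by auto
  have "int (length (filter ((<) j) (open_stack lam C (Suc s)))) =
      ht lam (Suc s) - ht lam (run_start C j (Suc s))" for j
  proof (cases "j < C s")
    case j: True
    have "int (length (filter ((<) j) (open_stack lam C s))) = ht lam s - ht lam (run_start C j s)"
      using inv by (simp add: stack_inv_def)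
    then show ?thesis using j True s by (simp add: ht_Suc)
  next
    case False
    then have "filter ((<) j) (open_stack lam C s) = []" using le by (auto simp: filter_empty_conv)
    then show ?thesis using False True by simp
  qed
  moreover have "sorted_wrt (\<ge>) (open_stack lam C (Suc s))" using le sorted True by simp
  moreover have "int (length (open_stack lam C (Suc s))) = ht lam (Suc s) + 1"
    using inv True s by (simp add: stack_inv_def ht_Suc) 
  moreover have "\<forall>c\<in>set (open_stack lam C (Suc s)). c \<le> K (Suc s)"
    using a le True by auto
  ultimately show ?thesis unfolding stack_inv_def by blast
next
  case False
  have a: "K s \<le> K (Suc s)" "C s = hd (open_stack lam C s)"
    using assms False by (auto simp: config_step_def)
  obtain st where st: "open_stack lam C s = C s # st"
    using a stack_nonempty by (cases "open_stack lam C s") auto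
  have "int (length (filter ((<) j) (open_stack lam C (Suc s)))) =
      ht lam (Suc s) - ht lam (run_start C j (Suc s))" for j
  proof (cases "j < C s")
    case j: True
    have "int (length (filter ((<) j) (open_stack lam C s))) = ht lam s - ht lam (run_start C j s)"
      using inv by (simp add: stack_inv_def)
    then show ?thesis using j False s by (simp add: st ht_Suc)
  next
    case j: False
    then have "filter ((<) j) (open_stack lam C s) = []"
      using filter_less_pos[OF _ stack_nonempty, of j] inv a(2) by (auto simp: stack_inv_def)
    then show ?thesis using False j by (simp add: st)
  qed
  moreover have "sorted_wrt (\<ge>) (open_stack lam C (Suc s))"
    using inv False by (simp add: stack_inv_def st)
  moreover have "int (length (open_stack lam C (Suc s))) = ht lam (Suc s) + 1"
    using inv False s by (simp add: stack_inv_def ht_Suc st) 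
  moreover have "\<forall>c\<in>set (open_stack lam C (Suc s)). c \<le> K (Suc s)"
    using a(1) inv False by (auto simp: stack_inv_def st)
  ultimately show ?thesis unfolding stack_inv_def by blast
qed

lemma config_step_layer_step:
  assumes "config_step lam K C s"
  shows "layer_step lam K C s"
proof -
  have inv': "stack_inv lam K C (Suc s)" by (rule config_step_inv[OF assms])
  have le: "ht lam (run_start C j (Suc s)) \<le> ht lam (Suc s)" for j
    using inv' unfolding stack_inv_def by (smt (verit) of_nat_0_le_iff)
  have hd_le: "hd (open_stack lam C s) \<le> C s"
    using assms by (auto simp: config_step_def up_choices_def split: if_splits)
  have eq: "ht lam s = ht lam (run_start C j s)" if "C s \<le> j" for j
    using hd_stack_iff[of j] run_start_ht_le[of j] hd_le that by simp
  have "hd (open_stack lam C s) \<le> K s"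
    using inv stack_nonempty by (simp add: stack_inv_def)
  then have "C s \<le> K s \<and> C s \<le> K (Suc s)"
    using assms by (auto simp: config_step_def up_choices_def split: if_splits)
  then show ?thesis
    using assms le eq by (auto simp: layer_step_def config_step_def up_choices_def)
qed

lemma layer_step_config_step:
  assumes "layer_step lam K C s"
  shows "config_step lam K C s"
proof -
  have hd_le: "hd (open_stack lam C s) \<le> C s"
  proof (rule ccontr)
    assume "\<not> ?thesis"
    \<comment> \<open>Layer C s is the lowest one whose run stops at s, so there the run must be
      back at its starting height.\<close>
    moreover have "ht lam s = ht lam (run_start C (C s) s)"
      using assms unfolding layer_step_def by blast
    ultimately show False using hd_stack_iff[of "C s"] by simp
  qed
  have "C s \<le> hd (open_stack lam C s)" if "\<not> lam ! s"
  proof (rule ccontr)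
    \<comment> \<open>In this layer the run is not above its start, yet it would continue through
      the down-step and so fall below it.\<close>
    let ?j = "hd (open_stack lam C s)"
    assume "\<not> ?thesis"
    then have "run_start C ?j (Suc s) = run_start C ?j s" by simp
    moreover have "ht lam (run_start C ?j (Suc s)) \<le> ht lam (Suc s)"
      using assms by (simp add: layer_step_def del: run_start.simps)
    ultimately show False using hd_stack_iff[of ?j] that s by (simp add: ht_Suc)
  qed
  then show ?thesis using assms hd_le
    by (auto simp: layer_step_def config_step_def up_choices_def)
qed

end

text \<open>The two step conditions agree only under \<open>stack_inv\<close>, which propagates
  along configuration steps. The inner fact \<open>inv\<close> therefore assumes merely that the
  invariant yields the next step, which fits both directions.\<close>

lemma layering_iff_config:
  assumes "ballot_path lam"
  shows "layering lam K C \<longleftrightarrow> K 0 = 0 \<and> config lam 0 [0] (encode (length lam) K C)"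
proof -
  let ?N = "length lam"
  have inv: "m \<le> ?N \<Longrightarrow> stack_inv lam K C m"
    if "\<And>s. s < ?N \<Longrightarrow> stack_inv lam K C s \<Longrightarrow> config_step lam K C s" for m
  proof (induction m)
    case 0
    then show ?case by (simp add: stack_inv_0)
  next
    case (Suc m)
    then show ?case using config_step_inv[OF assms] that by simp
  qed
  have "(\<forall>s<?N. layer_step lam K C s) \<longleftrightarrow> (\<forall>s<?N. config_step lam K C s)"
  proof
    assume l: "\<forall>s<?N. layer_step lam K C s"
    have c: "config_step lam K C s" if "s < ?N" "stack_inv lam K C s" for s
      using layer_step_config_step[OF assms that] l that(1) by blast
    show "\<forall>s<?N. config_step lam K C s" using inv[OF c] c by (meson less_imp_le)
  next
    assume c: "\<forall>s<?N. config_step lam K C s"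
    then have "stack_inv lam K C s" if "s < ?N" for s using inv[of s] that by simp
    then show "\<forall>s<?N. layer_step lam K C s"
      using c config_step_layer_step[OF assms] by blast
  qed
  then show ?thesis using config_encode[of lam K C] unfolding layering_def by (metis (no_types))
qed

section \<open>Tilings from layerings\<close>

definition box :: "bool list \<Rightarrow> nat \<Rightarrow> nat \<Rightarrow> int \<times> int" where
  "box lam j a = (int a, ht lam a + 1 + 2 * int j)"

lemma box_eq_iff [simp]: "box lam j a = box lam j' a' \<longleftrightarrow> a = a' \<and> j = j'"
  by (auto simp: box_def)

lemma fst_box [simp]: "fst (box lam j a) = int a"
  by (simp add: box_def)

definition gap :: "bool list \<Rightarrow> bool list \<Rightarrow> nat \<Rightarrow> nat" where
  "gap lam mu a = nat ((ht mu a - ht lam a) div 2)"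

lemma gap_0 [simp]: "gap lam mu 0 = 0"
  by (simp add: gap_def)

lemma weakly_above_iff:
  "weakly_above mu lam \<longleftrightarrow> length mu = length lam \<and> (\<forall>a\<le>length lam. ht lam a \<le> ht mu a)"
  unfolding weakly_above_def ht_def
  by (metis atLeastAtMost_iff nonneg_int_cases of_nat_0_le_iff of_nat_le_iff)

lemma ht_gap:
  assumes "weakly_above mu lam" "a \<le> length lam"
  shows "ht mu a = ht lam a + 2 * int (gap lam mu a)"
proof -
  have par: "even (ht mu a + int a)" "even (ht lam a + int a)" and le: "ht lam a \<le> ht mu a"
    using assms even_ht[of a mu] even_ht[of a lam] by (auto simp: weakly_above_iff)
  obtain k where "ht mu a - ht lam a = 2 * k" "0 \<le> k"
  proof -
    have "even (ht mu a - ht lam a)" using par by auto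
    then obtain k where "ht mu a - ht lam a = 2 * k" by (elim evenE)
    then show ?thesis using le that by fastforce
  qed
  then show ?thesis by (simp add: gap_def)
qed

text \<open>The bound b + 1 <= a of the shifted diagram is automatic below \<open>mu\<close>, whose
  height at a is at most a; column 0 contributes nothing because the gap is 0 there.\<close>

lemma region_eq:
  assumes "weakly_above mu lam"
  shows "shiftedS lam - shiftedS mu = {box lam j a | a j. a \<le> length lam \<and> j < gap lam mu a}"
proof (intro set_eqI iffI)
  fix p assume p: "p \<in> shiftedS lam - shiftedS mu"
  obtain x b where xb: "p = (x, b)" by (cases p)
  have len: "length mu = length lam" using assms by (simp add: weakly_above_iff)
  from p xb len have h: "odd (x + b)" "1 \<le> x" "x \<le> int (length lam)" "height lam x \<le> b - 1"
      "b + 1 \<le> x" "\<not> height mu x \<le> b - 1"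
    by (auto simp: shiftedS_def)
  define a where "a = nat x"
  have a: "x = int a" "a \<le> length lam" using h by (auto simp: a_def)
  have g: "ht mu a = ht lam a + 2 * int (gap lam mu a)" by (rule ht_gap[OF assms a(2)])
  have ev: "even (ht lam a + int a)" by (rule even_ht[OF a(2)])
  have le: "ht lam a \<le> b - 1" "\<not> ht mu a \<le> b - 1" "odd (int a + b)" using h a by (auto simp: ht_def)
  then have "even (b - 1 - ht lam a)" using ev by simp
  then obtain k where k: "b - 1 - ht lam a = 2 * k" by (elim evenE)
  define j where "j = nat k"
  have "b = ht lam a + 1 + 2 * int j" "j < gap lam mu a"
    using k le g unfolding j_def by linarith+
  then show "p \<in> {box lam j a | a j. a \<le> length lam \<and> j < gap lam mu a}"
    using a xb by (auto simp: box_def)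
next
  fix p assume "p \<in> {box lam j a | a j. a \<le> length lam \<and> j < gap lam mu a}"
  then obtain a j where p: "p = box lam j a" "a \<le> length lam" "j < gap lam mu a" by auto
  have len: "length mu = length lam" using assms by (simp add: weakly_above_iff)
  have g: "ht mu a = ht lam a + 2 * int (gap lam mu a)" by (rule ht_gap[OF assms p(2)])
  have ev: "even (ht lam a + int a)" by (rule even_ht[OF p(2)])
  have "ht mu a \<le> int a" using ht_le[of a mu] p(2) len by simp
  moreover have "a \<noteq> 0" using p(3) by (cases a) auto
  ultimately show "p \<in> shiftedS lam - shiftedS mu"
    using p g ev len by (auto simp: box_def shiftedS_def ht_def)
qed

section \<open>Listings of tiles, and tiles as runs\<close>

lemma chain_fst:
  assumes "ballot_chain cs" "i < length cs"
  shows "fst (cs ! i) = fst (hd cs) + int i"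
  using assms(2)
proof (induction i)
  case 0
  then show ?case by (simp add: hd_conv_nth)
next
  case (Suc i)
  then show ?case using assms(1) by (auto simp: ballot_chain_def)
qed

lemma chain_distinct:
  assumes "ballot_chain cs"
  shows "distinct cs"
  using chain_fst[OF assms] by (auto simp: distinct_conv_nth) (metis add_left_cancel of_nat_eq_iff)

text \<open>First coordinates increase by one along a chain, so the set of boxes determines the
  order. This makes the choice in \<open>tile_list\<close> unambiguous.\<close>

lemma chain_unique:
  assumes "ballot_chain cs" "ballot_chain ds" "set cs = set ds"
  shows "cs = ds"
proof -
  have ne: "cs \<noteq> []" "ds \<noteq> []" using assms by (auto simp: ballot_chain_def)
  have len: "length cs = length ds"
    using assms chain_distinct distinct_card by metis
  have ge: "fst (hd ds) \<le> fst (hd cs)"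
    if "ballot_chain cs" "ballot_chain ds" "set cs = set ds" "cs \<noteq> []" for cs ds :: "(int \<times> int) list"
  proof -
    have "hd cs \<in> set ds" using that by (metis hd_in_set)
    then obtain i where "i < length ds" "hd cs = ds ! i" by (metis in_set_conv_nth)
    then show ?thesis using chain_fst[OF that(2)] by simp
  qed
  have hd: "fst (hd cs) = fst (hd ds)"
    using ge[OF assms ne(1)] ge[OF assms(2,1) assms(3)[symmetric] ne(2)] by simp
  show ?thesis
  proof (rule nth_equalityI[OF len])
    fix i assume i: "i < length cs"
    then have "cs ! i \<in> set ds" using assms(3) nth_mem by blast
    then obtain k where k: "k < length ds" "cs ! i = ds ! k" by (metis in_set_conv_nth)
    then have "k = i" using chain_fst[OF assms(1) i] chain_fst[OF assms(2) k(1)] hd by simp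
    then show "cs ! i = ds ! i" using k by simp
  qed
qed

lemma tile_list_eq: "ballot_chain cs \<Longrightarrow> set cs = T \<Longrightarrow> tile_list T = cs"
  unfolding tile_list_def by (rule some_equality) (auto intro: chain_unique)

definition run_list :: "bool list \<Rightarrow> nat \<Rightarrow> nat \<Rightarrow> nat \<Rightarrow> (int \<times> int) list" where
  "run_list lam j a b = map (box lam j) [a..<Suc b]"

lemma set_run_list: "set (run_list lam j a b) = box lam j ` {a..b}"
  by (auto simp: run_list_def)

lemma hd_run_list: "a \<le> b \<Longrightarrow> hd (run_list lam j a b) = box lam j a"
  by (simp add: run_list_def hd_map del: upt_Suc)

lemma last_run_list: "a \<le> b \<Longrightarrow> last (run_list lam j a b) = box lam j b"
  by (simp add: run_list_def)

lemma ballot_chain_run_list: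
  assumes "a \<le> b" "b \<le> length lam"
  shows "ballot_chain (run_list lam j a b) \<longleftrightarrow> (\<forall>x\<in>{a..b}. ht lam a \<le> ht lam x)"
proof -
  have "fst (run_list lam j a b ! Suc i) = fst (run_list lam j a b ! i) + 1 \<and>
      (snd (run_list lam j a b ! Suc i) = snd (run_list lam j a b ! i) + 1 \<or>
       snd (run_list lam j a b ! Suc i) = snd (run_list lam j a b ! i) - 1)"
    if "Suc i < length (run_list lam j a b)" for i
    using that assms ht_Suc[of "a + i" lam]
    by (auto simp: run_list_def box_def nth_append less_Suc_eq_le simp del: upt_Suc)
  moreover have "run_list lam j a b \<noteq> []" using assms by (simp add: run_list_def)
  ultimately show ?thesis
    using assms unfolding ballot_chain_def
    by (auto simp: set_run_list hd_run_list last_run_list box_def)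
qed

lemma chain_run_list:
  assumes cs: "ballot_chain cs" and layer: "\<And>p. p \<in> set cs \<Longrightarrow> \<exists>x. p = box lam j x"
  shows "\<exists>a b. a \<le> b \<and> cs = run_list lam j a b"
proof -
  have ne: "cs \<noteq> []" using cs by (simp add: ballot_chain_def)
  then obtain a where a: "hd cs = box lam j a" using layer[of "hd cs"] by auto
  have nth: "cs ! i = box lam j (a + i)" if i: "i < length cs" for i
  proof -
    obtain x where x: "cs ! i = box lam j x" using layer[OF nth_mem[OF i]] by auto
    with chain_fst[OF cs i] a have "int x = int a + int i" by simp
    then have "x = a + i" by simp
    then show ?thesis using x by simp
  qed
  have "cs = run_list lam j a (a + length cs - 1)"
    by (rule nth_equalityI) (use ne in \<open>auto simp: run_list_def nth simp del: upt_Suc\<close>)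
  moreover have "a \<le> a + length cs - 1" using ne by (cases cs) auto
  ultimately show ?thesis by blast
qed

definition run_tile :: "bool list \<Rightarrow> (nat \<Rightarrow> nat) \<Rightarrow> nat \<Rightarrow> nat \<Rightarrow> (int \<times> int) set" where
  "run_tile lam C j a = box lam j ` {x. x \<le> length lam \<and> run_start C j x = run_start C j a}"

definition tiles_of :: "bool list \<Rightarrow> (nat \<Rightarrow> nat) \<Rightarrow> (nat \<Rightarrow> nat) \<Rightarrow> (int \<times> int) set set" where
  "tiles_of lam K C = {run_tile lam C j a | a j. a \<le> length lam \<and> j < K a}"

definition path_of :: "bool list \<Rightarrow> (nat \<Rightarrow> nat) \<Rightarrow> bool list" where
  "path_of lam K = map (\<lambda>s. ht lam s + 2 * int (K s) < ht lam (Suc s) + 2 * int (K (Suc s))) [0..<length lam]"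

lemma run_start_le: "run_start C j s \<le> s"
  by (induction s) auto

lemma run_start_connected: "run_start C j s \<le> x \<Longrightarrow> x < s \<Longrightarrow> j < C x"
proof (induction s)
  case (Suc s)
  then show ?case by (cases "j < C s") (auto simp: less_Suc_eq)
qed simp

lemma run_start_eqI: "\<lbrakk>x \<le> y; \<And>z. x \<le> z \<Longrightarrow> z < y \<Longrightarrow> j < C z\<rbrakk> \<Longrightarrow> run_start C j y = run_start C j x"
proof (induction y)
  case (Suc y)
  then show ?case by (cases "x = Suc y") auto
qed simp

lemma run_start_eq_iff:
  "x \<le> y \<Longrightarrow> run_start C j x = run_start C j y \<longleftrightarrow> (\<forall>z. x \<le> z \<and> z < y \<longrightarrow> j < C z)"
proof (intro iffI allI impI)
  fix z assume "run_start C j x = run_start C j y" "x \<le> z \<and> z < y"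
  then show "j < C z" using run_start_connected[of C j y z] run_start_le[of C j x] by simp
qed (rule run_start_eqI[symmetric], auto)

lemma run_start_idem: "run_start C j s \<le> x \<Longrightarrow> x \<le> s \<Longrightarrow> run_start C j x = run_start C j s"
  using run_start_connected[of C j s] by (simp add: run_start_eq_iff)

text \<open>Connection at level j + 1 forces connection at level j, since it means j + 1 < C. This
  is the source of cover-inclusivity.\<close>

lemma run_start_antimono: "run_start C (Suc j) x = run_start C (Suc j) y \<Longrightarrow> run_start C j x = run_start C j y"
proof -
  have "run_start C j x = run_start C j y" if "x \<le> y" "run_start C (Suc j) x = run_start C (Suc j) y" for x y
    using that by (auto simp: run_start_eq_iff intro: Suc_lessD)
  then show "run_start C (Suc j) x = run_start C (Suc j) y \<Longrightarrow> run_start C j x = run_start C j y"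
    by (metis nle_le)
qed

lemma run_interval:
  assumes "a \<le> n"
  shows "\<exists>b\<ge>a. b \<le> n \<and> run_start C j b = run_start C j a \<and> {x. x \<le> n \<and> run_start C j x = run_start C j a} = {run_start C j a..b} \<and>
    (b = n \<or> C b \<le> j)"
proof -
  let ?S = "{x. x \<le> n \<and> run_start C j x = run_start C j a}"
  have fin: "finite ?S" by (rule finite_subset[of _ "{..n}"]) auto
  define b where "b = Max ?S"
  have b: "b \<in> ?S" unfolding b_def using assms fin by (intro Max_in) auto
  have ab: "x \<le> b" if "x \<in> ?S" for x unfolding b_def using fin that by (rule Max_ge)
  have "?S = {run_start C j a..b}"
  proof (intro set_eqI iffI)
    fix x assume "x \<in> ?S"
    then show "x \<in> {run_start C j a..b}" using ab run_start_le[of C j x] by auto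
  next
    fix x assume "x \<in> {run_start C j a..b}"
    then show "x \<in> ?S" using b run_start_idem[of C j b x] by auto
  qed
  moreover have "b = n \<or> C b \<le> j"
  proof (rule ccontr)
    assume "\<not> ?thesis"
    then have "Suc b \<in> ?S" using b by auto
    then show False using ab[of "Suc b"] by simp
  qed
  moreover have "a \<le> b" "b \<le> n" "run_start C j b = run_start C j a" using b ab[of a] assms by auto
  ultimately show ?thesis by blast
qed

text \<open>Counts the down-steps of the current run; for a tile of length (2n, n') the final count
  is n.\<close>

primrec run_D :: "bool list \<Rightarrow> (nat \<Rightarrow> nat) \<Rightarrow> nat \<Rightarrow> nat \<Rightarrow> nat" where
  "run_D lam C j 0 = 0"
| "run_D lam C j (Suc s) = (if j < C s then run_D lam C j s + (if lam ! s then 0 else 1) else 0)"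

lemma run_D: "s \<le> length lam \<Longrightarrow>
  2 * int (run_D lam C j s) = int s - int (run_start C j s) - (ht lam s - ht lam (run_start C j s))"
proof (induction s)
  case (Suc s)
  then show ?case by (auto simp: ht_Suc)
qed simp

locale layered =
  fixes lam :: "bool list" and K C :: "nat \<Rightarrow> nat"
  assumes ballot: "ballot_path lam" and layering: "layering lam K C"
begin

lemma step: "s < length lam \<Longrightarrow> layer_step lam K C s"
  using layering by (simp add: layering_def)

lemma K_0 [simp]: "K 0 = 0"
  using layering by (simp add: layering_def)

lemma C_le: "s < length lam \<Longrightarrow> C s \<le> K s \<and> C s \<le> K (Suc s)"
  using step by (simp add: layer_step_def)

lemma run_start_ht_le': "s \<le> length lam \<Longrightarrow> ht lam (run_start C j s) \<le> ht lam s"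
proof (cases s)
  case (Suc m)
  assume "s \<le> length lam"
  with Suc step[of m] show ?thesis by (simp add: layer_step_def del: run_start.simps)
qed simp

lemma run_start_ht_eq: "s < length lam \<Longrightarrow> C s \<le> j \<Longrightarrow> ht lam (run_start C j s) = ht lam s"
  using step[of s] by (simp add: layer_step_def)

lemma run_K: "\<lbrakk>j < K a; a \<le> length lam; x \<le> length lam; run_start C j x = run_start C j a\<rbrakk> \<Longrightarrow> j < K x"
proof (cases x a rule: linorder_cases)
  case less
  assume "a \<le> length lam" "run_start C j x = run_start C j a"
  then have "j < C x" "x < length lam" using less run_start_eq_iff[of x a C j] by auto
  then show ?thesis using C_le[of x] by auto
next
  case greater
  assume "x \<le> length lam" "run_start C j x = run_start C j a"
  then obtain m where "x = Suc m" "j < C m" "m < length lam"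
    using greater run_start_eq_iff[of a x C j] by (cases x) auto
  then show ?thesis using C_le[of m] by auto
qed simp

lemma ht_path_of: "s \<le> length lam \<Longrightarrow> ht (path_of lam K) s = ht lam s + 2 * int (K s)"
proof (induction s)
  case (Suc s)
  then show ?case using step[of s]
    by (auto simp: ht_Suc path_of_def layer_step_def split: if_splits)
qed simp

lemma length_path_of [simp]: "length (path_of lam K) = length lam"
  by (simp add: path_of_def)

lemma weakly_above_path_of: "weakly_above (path_of lam K) lam"
  by (simp add: weakly_above_iff ht_path_of)

lemma gap_path_of: "s \<le> length lam \<Longrightarrow> gap lam (path_of lam K) s = K s"
  by (simp add: gap_def ht_path_of)

lemma run_tile_list:
  assumes "b \<le> length lam" "b = length lam \<or> C b \<le> j"
  shows "ballot_chain (run_list lam j (run_start C j b) b)"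
    and "run_tile lam C j b = set (run_list lam j (run_start C j b) b)"
proof -
  obtain b' where b': "b \<le> b'" "b' \<le> length lam" "run_start C j b' = run_start C j b"
     "{x. x \<le> length lam \<and> run_start C j x = run_start C j b} = {run_start C j b..b'}"
    using run_interval[OF assms(1), of C j] by blast
  have "b' = b"
  proof (rule ccontr)
    assume "b' \<noteq> b"
    then have "b < b'" "b < length lam" using b'(1,2) by simp_all
    then show False using run_start_eq_iff[OF b'(1), of C j] b'(3) assms(2) by auto
  qed
  then show "run_tile lam C j b = set (run_list lam j (run_start C j b) b)"
    using b'(4) by (simp add: run_tile_def set_run_list)
  show "ballot_chain (run_list lam j (run_start C j b) b)"
    unfolding ballot_chain_run_list[OF run_start_le assms(1)]
  proof
    fix x assume "x \<in> {run_start C j b..b}"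
    then have "run_start C j x = run_start C j b" "x \<le> length lam"
      using run_start_idem[of C j b x] assms(1) by auto
    then show "ht lam (run_start C j b) \<le> ht lam x" using run_start_ht_le'[of x j] by simp
  qed
qed

text \<open>Indexing tiles by their rightmost box makes the parametrization injective and shows at
  once whether a tile is anchored.\<close>

definition ends :: "(nat \<times> nat) set" where
  "ends = (SIGMA b:{..length lam}. {j. j < K b \<and> (b = length lam \<or> C b \<le> j)})"

lemma finite_ends: "finite ends"
  unfolding ends_def by (intro finite_SigmaI) auto

lemma tiles_of_ends: "tiles_of lam K C = (\<lambda>(b, j). run_tile lam C j b) ` ends"
proof (intro set_eqI iffI)
  fix T assume "T \<in> tiles_of lam K C"
  then obtain a j where T: "T = run_tile lam C j a" "a \<le> length lam" "j < K a"
    by (auto simp: tiles_of_def)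
  from run_interval[OF T(2), of C j] obtain b where b: "a \<le> b" "b \<le> length lam"
    "b = length lam \<or> C b \<le> j" and r: "run_start C j b = run_start C j a" by blast
  have "j < K b" by (rule run_K[OF T(3,2) b(2) r])
  then have "(b, j) \<in> ends" using b by (simp add: ends_def)
  moreover have "T = run_tile lam C j b" using T r by (simp add: run_tile_def)
  ultimately show "T \<in> (\<lambda>(b, j). run_tile lam C j b) ` ends" by force
next
  fix T assume "T \<in> (\<lambda>(b, j). run_tile lam C j b) ` ends"
  then show "T \<in> tiles_of lam K C" by (auto simp: tiles_of_def ends_def)
qed

lemma tile_list_ends: "(b, j) \<in> ends \<Longrightarrow> tile_list (run_tile lam C j b) = run_list lam j (run_start C j b) b"
  by (rule tile_list_eq) (auto simp: ends_def run_tile_list)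

lemma last_ends: "(b, j) \<in> ends \<Longrightarrow> last (tile_list (run_tile lam C j b)) = box lam j b"
  by (simp add: tile_list_ends last_run_list run_start_le)

lemma inj_ends: "inj_on (\<lambda>(b, j). run_tile lam C j b) ends"
proof (rule inj_onI, clarify)
  fix b j b' j' assume "(b, j) \<in> ends" "(b', j') \<in> ends" "run_tile lam C j b = run_tile lam C j' b'"
  then have "box lam j b = box lam j' b'" using last_ends by metis
  then show "b = b' \<and> j = j'" by simp
qed

lemma anchored_ends: "(b, j) \<in> ends \<Longrightarrow> anchored lam (run_tile lam C j b) \<longleftrightarrow> b = length lam"
  by (simp add: anchored_def last_ends)

lemma tile_rise_ends: "(b, j) \<in> ends \<Longrightarrow>
    tile_rise (run_tile lam C j b) = ht lam b - ht lam (run_start C j b)"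
  by (simp add: tile_rise_def tile_list_ends last_run_list hd_run_list run_start_le) (simp add: box_def)

lemma tile_n_ends:
  assumes "(b, j) \<in> ends"
  shows "tile_n (run_tile lam C j b) = run_D lam C j b"
proof -
  have b: "b \<le> length lam" "b = length lam \<or> C b \<le> j" using assms by (auto simp: ends_def)
  have "inj_on (box lam j) A" for A by (auto simp: inj_on_def)
  then have "card (run_tile lam C j b) = Suc b - run_start C j b"
    by (simp add: run_tile_list[OF b] set_run_list card_image)
  then have "int (card (run_tile lam C j b)) = int b + 1 - int (run_start C j b)"
    using run_start_le[of C j b] by linarith
  then show ?thesis unfolding tile_n_def tile_rise_ends[OF assms]
    using run_D[OF b(1), of C j] by simp
qed

lemma tiling: "ballot_tiling lam (path_of lam K) (tiles_of lam K C)"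
proof -
  have "\<Union> (tiles_of lam K C) = {box lam j a | a j. a \<le> length lam \<and> j < K a}"
    by (auto simp: tiles_of_def run_tile_def run_K)
  also have "\<dots> = shiftedS lam - shiftedS (path_of lam K)"
    unfolding region_eq[OF weakly_above_path_of] using gap_path_of by (metis (no_types, lifting))
  finally have "is_partition (tiles_of lam K C) (shiftedS lam - shiftedS (path_of lam K))"
    unfolding is_partition_def
    by (auto simp: tiles_of_def run_tile_def)
  moreover have "ballot_tile T \<and> (1 \<le> tile_rise T \<longrightarrow> anchored lam T)" if "T \<in> tiles_of lam K C" for T
  proof -
    obtain b j where bj: "(b, j) \<in> ends" "T = run_tile lam C j b" using \<open>T \<in> _\<close> unfolding tiles_of_ends by auto
    then have b: "b \<le> length lam" "b = length lam \<or> C b \<le> j" by (auto simp: ends_def)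
    then have "ballot_tile T" using run_tile_list[OF b] bj(2) unfolding ballot_tile_def by blast
    moreover have "b = length lam" if "1 \<le> tile_rise T"
      using that b run_start_ht_eq[of b j] tile_rise_ends[OF bj(1)] bj(2) by force
    ultimately show ?thesis using anchored_ends bj by auto
  qed
  ultimately show ?thesis unfolding ballot_tiling_def by blast
qed

lemma cover: "cover_inclusive lam (tiles_of lam K C)"
  unfolding cover_inclusive_def
proof
  fix T assume "T \<in> tiles_of lam K C"
  then obtain a j where T: "T = run_tile lam C j a" "a \<le> length lam" "j < K a"
    by (auto simp: tiles_of_def)
  show "below_path lam (shift_down T) \<or> (\<exists>T'\<in>tiles_of lam K C. shift_down T \<subseteq> T')"
  proof (cases j)
    case 0
    then have "below_path lam (shift_down T)"
      by (auto simp: T below_path_def shift_down_def run_tile_def box_def ht_def)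
    then show ?thesis ..
  next
    case (Suc i)
    have "shift_down T \<subseteq> run_tile lam C i a"
    proof
      fix p assume "p \<in> shift_down T"
      then obtain x where "x \<le> length lam" "run_start C j x = run_start C j a"
        "p = (\<lambda>(a, b). (a, b - 2)) (box lam j x)"
        unfolding T shift_down_def run_tile_def by blast
      then show "p \<in> run_tile lam C i a"
        using run_start_antimono[of C i x a] Suc by (auto simp: run_tile_def box_def image_iff)
    qed
    moreover have "run_tile lam C i a \<in> tiles_of lam K C"
    proof -
      have "i < K a" using T(3) Suc by simp
      then show ?thesis using T(2) unfolding tiles_of_def by blast
    qed
    ultimately show ?thesis by blast
  qed
qed

text \<open>Double counting: the first sum collects the tiles ended before column m, the second the
  runs still open there. Passing step m closes K m - C m runs, each with its additional 1, and a
  down-step adds one to each of the C m runs that continue.\<close>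

lemma sum_run_D: "m \<le> length lam \<Longrightarrow>
  (\<Sum>s<m. \<Sum>j=C s..<K s. run_D lam C j s + 1) + (\<Sum>j<K m. run_D lam C j m) =
  (\<Sum>s<m. if lam ! s then K s - C s else K s)"
proof (induction m)
  case 0
  then show ?case by simp
next
  case (Suc m)
  then have c: "C m \<le> K m" "C m \<le> K (Suc m)" using C_le[of m] by auto
  have split: "(\<Sum>j<k. f j) = (\<Sum>j<C m. f j) + (\<Sum>j=C m..<k. f j)" if "C m \<le> k"
    for k and f :: "nat \<Rightarrow> nat"
    using that by (metis sum.atLeastLessThan_concat lessThan_atLeast0 le0)
  have "(\<Sum>j<K (Suc m). run_D lam C j (Suc m)) = (\<Sum>j<C m. run_D lam C j m + (if lam ! m then 0 else 1))"
    unfolding split[OF c(2)] by simp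
  also have "\<dots> = (\<Sum>j<C m. run_D lam C j m) + (if lam ! m then 0 else C m)"
    by (simp add: sum.distrib del: run_D.simps)
  finally have 1: "(\<Sum>j<K (Suc m). run_D lam C j (Suc m)) = (\<Sum>j<C m. run_D lam C j m) + (if lam ! m then 0 else C m)" .
  have 2: "(\<Sum>j=C m..<K m. run_D lam C j m + 1) = (\<Sum>j=C m..<K m. run_D lam C j m) + (K m - C m)"
    by (simp add: sum.distrib sum_Suc del: run_D.simps)
  have 3: "(\<Sum>j<K m. run_D lam C j m) = (\<Sum>j<C m. run_D lam C j m) + (\<Sum>j=C m..<K m. run_D lam C j m)"
    by (rule split[OF c(1)])
  show ?case using Suc 1 2 3 c by (auto simp del: run_D.simps)
qed

lemma art3_tiles_of: "art3 lam (tiles_of lam K C) = (\<Sum>s<length lam. if lam ! s then K s - C s else K s)"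
proof -
  let ?N = "length lam"
  have "art3 lam (tiles_of lam K C) = (\<Sum>(b, j)\<in>ends. art3_tile lam (run_tile lam C j b))"
    unfolding art3_def tiles_of_ends
    by (subst sum.reindex[OF inj_ends]) (auto intro!: sum.cong)
  also have "\<dots> = (\<Sum>(b, j)\<in>ends. if b = ?N then run_D lam C j b else run_D lam C j b + 1)"
    by (intro sum.cong refl) (auto simp: art3_tile_def anchored_ends tile_n_ends)
  also have "\<dots> = (\<Sum>b\<le>?N. \<Sum>j | j < K b \<and> (b = ?N \<or> C b \<le> j).
      if b = ?N then run_D lam C j b else run_D lam C j b + 1)"
    unfolding ends_def by (subst sum.Sigma[symmetric]) auto
  also have "{..?N} = insert ?N {..<?N}" by auto
  also have "(\<Sum>b\<in>insert ?N {..<?N}. \<Sum>j | j < K b \<and> (b = ?N \<or> C b \<le> j).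
      if b = ?N then run_D lam C j b else run_D lam C j b + 1) =
     (\<Sum>j<K ?N. run_D lam C j ?N) + (\<Sum>b<?N. \<Sum>j | j < K b \<and> (b = ?N \<or> C b \<le> j).
      if b = ?N then run_D lam C j b else run_D lam C j b + 1)"
    by (subst sum.insert) (auto simp: lessThan_def)
  also have "(\<Sum>b<?N. \<Sum>j | j < K b \<and> (b = ?N \<or> C b \<le> j).
      if b = ?N then run_D lam C j b else run_D lam C j b + 1) = (\<Sum>b<?N. \<Sum>j=C b..<K b. run_D lam C j b + 1)"
    by (intro sum.cong refl) auto
  finally show ?thesis using sum_run_D[of ?N] by simp
qed

lemma tiles2_tiles_of: "tiles2 lam (tiles_of lam K C) = K (length lam)"
proof -
  let ?N = "length lam"
  have "{T \<in> tiles_of lam K C. anchored lam T} = (\<lambda>(b, j). run_tile lam C j b) ` ({?N} \<times> {..<K ?N})"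
  proof (intro set_eqI iffI)
    fix T assume "T \<in> {T \<in> tiles_of lam K C. anchored lam T}"
    then obtain b j where "(b, j) \<in> ends" "T = run_tile lam C j b" "anchored lam T"
      unfolding tiles_of_ends by auto
    then show "T \<in> (\<lambda>(b, j). run_tile lam C j b) ` ({?N} \<times> {..<K ?N})"
      using anchored_ends by (auto simp: ends_def)
  next
    fix T assume "T \<in> (\<lambda>(b, j). run_tile lam C j b) ` ({?N} \<times> {..<K ?N})"
    then obtain j where "T = run_tile lam C j ?N" "j < K ?N" by auto
    moreover from this have "(?N, j) \<in> ends" by (simp add: ends_def)
    ultimately show "T \<in> {T \<in> tiles_of lam K C. anchored lam T}"
      using anchored_ends unfolding tiles_of_ends by force
  qed
  moreover have "inj_on (\<lambda>(b, j). run_tile lam C j b) ({?N} \<times> {..<K ?N})"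
    by (rule inj_on_subset[OF inj_ends]) (auto simp: ends_def)
  ultimately show ?thesis unfolding tiles2_def by (simp add: card_image)
qed

end

section \<open>Layerings from tilings\<close>

definition connected_layers :: "bool list \<Rightarrow> (int \<times> int) set set \<Rightarrow> nat \<Rightarrow> nat set" where
  "connected_layers lam B s = {j. \<exists>T\<in>B. box lam j s \<in> T \<and> box lam j (Suc s) \<in> T}"

definition connectivity :: "bool list \<Rightarrow> (int \<times> int) set set \<Rightarrow> nat \<Rightarrow> nat" where
  "connectivity lam B s = card (connected_layers lam B s)"

lemma down_closed_eq_lessThan:
  fixes A :: "nat set"
  assumes fin: "finite A" and down: "\<And>j. Suc j \<in> A \<Longrightarrow> j \<in> A"
  shows "A = {..<card A}"
proof -
  have ex: "\<exists>m. m \<notin> A" using fin infinite_UNIV_nat by (metis UNIV_eq_I)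
  define m where "m = (LEAST m. m \<notin> A)"
  have m: "m \<notin> A" unfolding m_def by (rule LeastI_ex[OF ex])
  have lt: "x \<in> A" if "x < m" for x using not_less_Least that unfolding m_def by blast
  have up: "m + x \<notin> A" for x
    by (induction x) (use m down in auto)
  have "A = {..<m}"
  proof (intro set_eqI iffI)
    fix x assume "x \<in> A"
    then show "x \<in> {..<m}" using up[of "x - m"] by (cases "x < m") auto
  qed (use lt in auto)
  then show ?thesis by simp
qed

lemma (in layered) connected_layers_tiles_of:
  assumes "s < length lam"
  shows "connected_layers lam (tiles_of lam K C) s = {..<C s}"
proof (intro set_eqI iffI)
  fix j assume "j \<in> connected_layers lam (tiles_of lam K C) s"
  then have "run_start C j s = run_start C j (Suc s)"
    by (auto simp: connected_layers_def tiles_of_def run_tile_def simp del: run_start.simps)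
  then have "\<forall>z. s \<le> z \<and> z < Suc s \<longrightarrow> j < C z"
    using run_start_eq_iff[of s "Suc s" C j] by simp
  then show "j \<in> {..<C s}" by simp
next
  fix j assume j: "j \<in> {..<C s}"
  then have "box lam j s \<in> run_tile lam C j s" "box lam j (Suc s) \<in> run_tile lam C j s"
    using assms by (auto simp: run_tile_def)
  moreover have "run_tile lam C j s \<in> tiles_of lam K C"
  proof -
    have "j < K s" "s \<le> length lam" using C_le[OF assms] j assms by auto
    then show ?thesis unfolding tiles_of_def by blast
  qed
  ultimately show "j \<in> connected_layers lam (tiles_of lam K C) s"
    unfolding connected_layers_def by blast
qed

locale tiled =
  fixes lam mu :: "bool list" and B :: "(int \<times> int) set set"
  assumes ballot: "ballot_path lam" and above: "weakly_above mu lam"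
    and tiling: "ballot_tiling lam mu B" and cover: "cover_inclusive lam B"
begin

abbreviation K :: "nat \<Rightarrow> nat" where "K \<equiv> gap lam mu"
abbreviation C :: "nat \<Rightarrow> nat" where "C \<equiv> connectivity lam B"

lemma Union_B: "\<Union> B = {box lam j a | a j. a \<le> length lam \<and> j < K a}"
  using tiling region_eq[OF above] by (simp add: ballot_tiling_def is_partition_def)

lemma in_tile: "T \<in> B \<Longrightarrow> p \<in> T \<Longrightarrow> \<exists>a j. p = box lam j a \<and> a \<le> length lam \<and> j < K a"
  using Union_B by blast

lemma box_in_tile:
  assumes "T \<in> B" "box lam j a \<in> T"
  shows "a \<le> length lam" "j < K a"
  using in_tile[OF assms] by auto

lemma box_covered: "a \<le> length lam \<Longrightarrow> j < K a \<Longrightarrow> \<exists>T\<in>B. box lam j a \<in> T"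
  using Union_B by blast

lemma disjoint: "T \<in> B \<Longrightarrow> T' \<in> B \<Longrightarrow> p \<in> T \<Longrightarrow> p \<in> T' \<Longrightarrow> T = T'"
  using tiling unfolding ballot_tiling_def is_partition_def by blast

text \<open>A box in layer at least 1 moves down to a box still above the path, which excludes the
  first alternative of cover-inclusivity.\<close>

lemma tile_below:
  assumes "T \<in> B" "box lam (Suc j) a \<in> T"
  shows "\<exists>T'\<in>B. shift_down T \<subseteq> T'"
proof -
  have "(int a, ht lam a + 1 + 2 * int j) \<in> shift_down T"
    using assms(2) by (force simp: shift_down_def box_def)
  then have "\<not> below_path lam (shift_down T)"
    by (force simp: below_path_def ht_def)
  then show ?thesis using cover assms(1) by (auto simp: cover_inclusive_def)
qed

lemma box_shift_down: "box lam (Suc j) a \<in> T \<Longrightarrow> shift_down T \<subseteq> T' \<Longrightarrow> box lam j a \<in> T'"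
  by (force simp: shift_down_def box_def)

text \<open>A tile whose first known box lies in layer 0 rests on the path; otherwise its translate is
  inside a tile of the layer below.\<close>
lemma tile_in_layer: "\<lbrakk>T \<in> B; box lam j a \<in> T; p \<in> T\<rbrakk> \<Longrightarrow> \<exists>x. p = box lam j x"
proof (induction j arbitrary: T a p)
  case 0
  obtain x i where p: "p = box lam i x" using in_tile[OF 0(1,3)] by auto
  show ?case
  proof (cases i)
    case (Suc i')
    then obtain T' where T': "T' \<in> B" "shift_down T \<subseteq> T'" using tile_below 0 p by blast
    have "(int a, ht lam a - 1) \<in> shift_down T"
      using 0(2) by (force simp: shift_down_def box_def)
    then obtain a' j' where "(int a, ht lam a - 1) = box lam j' a'" using in_tile[OF T'(1)] T'(2) by blast
    then show ?thesis by (auto simp: box_def)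
  qed (use p in auto)
next
  case (Suc j)
  then obtain T' where T': "T' \<in> B" "shift_down T \<subseteq> T'" using tile_below by blast
  have a: "box lam j a \<in> T'" by (rule box_shift_down[OF Suc.prems(2) T'(2)])
  have "(fst p, snd p - 2) \<in> T'" using Suc.prems(3) T'(2) by (force simp: shift_down_def)
  from Suc.IH[OF T'(1) a this] obtain x where "(fst p, snd p - 2) = box lam j x" ..
  then have "p = box lam (Suc j) x" by (cases p) (auto simp: box_def)
  then show ?case ..
qed

text \<open>By \<open>tile_in_layer\<close> the chain stays in one layer and follows the path, so
  the tile is an interval of columns. Its rise vanishes unless it is anchored.\<close>

lemma tile_interval:
  assumes "T \<in> B"
  shows "\<exists>a b j. a \<le> b \<and> b \<le> length lam \<and> T = box lam j ` {a..b} \<and>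
    (\<forall>x\<in>{a..b}. ht lam a \<le> ht lam x) \<and> (b = length lam \<or> ht lam b = ht lam a)"
proof -
  obtain cs where cs: "ballot_chain cs" "set cs = T"
    using tiling assms by (auto simp: ballot_tiling_def ballot_tile_def)
  then have "hd cs \<in> T" by (auto simp: ballot_chain_def)
  then obtain a0 j where "box lam j a0 \<in> T" using in_tile[OF assms, of "hd cs"] by auto
  then have "\<exists>x. p = box lam j x" if "p \<in> set cs" for p
    using tile_in_layer[OF assms _ , of j a0 p] that cs(2) by simp
  from chain_run_list[OF cs(1) this] obtain a b where ab: "a \<le> b" "cs = run_list lam j a b" by blast
  have T: "T = box lam j ` {a..b}" using cs(2) ab by (simp add: set_run_list)
  have b: "b \<le> length lam" using box_in_tile(1)[OF assms, of j b] T ab(1) by simp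
  have h: "\<forall>x\<in>{a..b}. ht lam a \<le> ht lam x"
    using ballot_chain_run_list[OF ab(1) b] cs(1) ab(2) by simp
  have tl: "tile_list T = run_list lam j a b" using tile_list_eq[OF cs] ab(2) by simp
  then have "tile_rise T = ht lam b - ht lam a"
    by (simp add: tile_rise_def last_run_list hd_run_list ab(1)) (simp add: box_def)
  moreover have "anchored lam T \<longleftrightarrow> b = length lam"
    by (simp add: anchored_def tl last_run_list ab(1))
  moreover have "1 \<le> tile_rise T \<longrightarrow> anchored lam T"
    using tiling assms by (simp add: ballot_tiling_def)
  moreover have "ht lam a \<le> ht lam b" using h ab(1) by simp
  ultimately have "b = length lam \<or> ht lam b = ht lam a" by linarith
  then show ?thesis using ab(1) b T h by blast
qed

lemma connected_layers_bounds:
  assumes "j \<in> connected_layers lam B s"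
  shows "s < length lam" "j < K s" "j < K (Suc s)"
proof -
  obtain T where T: "T \<in> B" "box lam j s \<in> T" "box lam j (Suc s) \<in> T"
    using assms unfolding connected_layers_def by blast
  show "s < length lam" "j < K s" "j < K (Suc s)"
    using box_in_tile[OF T(1,2)] box_in_tile[OF T(1,3)] by simp_all
qed

text \<open>Cover-inclusivity makes the set of connected layers downward closed, so its cardinality
  \<open>C s\<close> determines it.\<close>

lemma connected_layers_eq: "connected_layers lam B s = {..<C s}"
  unfolding connectivity_def
proof (rule down_closed_eq_lessThan)
  show "finite (connected_layers lam B s)"
    by (rule finite_subset[of _ "{..<K s}"]) (use connected_layers_bounds in auto)
  fix j assume "Suc j \<in> connected_layers lam B s"
  then obtain T where T: "T \<in> B" "box lam (Suc j) s \<in> T" "box lam (Suc j) (Suc s) \<in> T"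
    by (auto simp: connected_layers_def)
  obtain T' where T': "T' \<in> B" "shift_down T \<subseteq> T'" using tile_below[OF T(1,2)] by blast
  have "box lam j s \<in> T'" "box lam j (Suc s) \<in> T'"
    using box_shift_down[OF _ T'(2)] T(2,3) by simp_all
  then show "j \<in> connected_layers lam B s"
    using T'(1) unfolding connected_layers_def by blast
qed

lemma less_C_iff: "j < C s \<longleftrightarrow> (\<exists>T\<in>B. box lam j s \<in> T \<and> box lam j (Suc s) \<in> T)"
  using connected_layers_eq[of s] unfolding connected_layers_def by blast

lemma less_C_tile:
  assumes T: "T \<in> B" "T = box lam j ` {a..b}"
  shows "a \<le> x \<Longrightarrow> x < b \<Longrightarrow> j < C x" "x < b \<Longrightarrow> Suc x = a \<Longrightarrow> \<not> j < C x" "a \<le> b \<Longrightarrow> \<not> j < C b"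
proof -
  show "a \<le> x \<Longrightarrow> x < b \<Longrightarrow> j < C x"
    unfolding less_C_iff using T by (intro bexI[of _ T]) auto
  show "\<not> j < C x" if "x < b" "Suc x = a"
  proof
    assume "j < C x"
    then obtain T' where T': "T' \<in> B" "box lam j x \<in> T'" "box lam j (Suc x) \<in> T'"
      unfolding less_C_iff by blast
    have "box lam j (Suc x) \<in> T" using T(2) that by auto
    then have "T' = T" using disjoint T' T(1) by blast
    then show False using T'(2) T(2) that by auto
  qed
  show "\<not> j < C b" if "a \<le> b"
  proof
    assume "j < C b"
    then obtain T' where T': "T' \<in> B" "box lam j b \<in> T'" "box lam j (Suc b) \<in> T'"
      unfolding less_C_iff by blast
    have "box lam j b \<in> T" using T(2) that by auto
    then have "T' = T" using disjoint T' T(1) by blast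
    then show False using T'(3) T(2) by auto
  qed
qed

lemma run_start_tile:
  assumes T: "T \<in> B" "T = box lam j ` {a..b}" and x: "a \<le> x" "x \<le> b"
  shows "run_start C j x = a"
proof -
  have "run_start C j a = a"
    using less_C_tile(2)[OF T] x by (cases a) auto
  moreover have "run_start C j x = run_start C j a"
    by (rule run_start_eqI[OF x(1)]) (use less_C_tile(1)[OF T] x(2) in auto)
  ultimately show ?thesis by simp
qed

lemma run_tile_eq:
  assumes T: "T \<in> B" "T = box lam j ` {a..b}" and x: "a \<le> x" "x \<le> b"
  shows "run_tile lam C j x = T"
proof -
  have b: "b \<le> length lam" using box_in_tile(1)[OF T(1), of j b] T(2) x by auto
  have "{y. y \<le> length lam \<and> run_start C j y = a} = {a..b}"
  proof (intro set_eqI iffI)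
    fix y assume "y \<in> {y. y \<le> length lam \<and> run_start C j y = a}"
    then have y: "run_start C j y = a" by simp
    have "y \<le> b"
    proof (rule ccontr)
      assume "\<not> y \<le> b"
      then have "j < C b" using run_start_connected[of C j y b] y x by simp
      then show False using less_C_tile(3)[OF T] x by simp
    qed
    then show "y \<in> {a..b}" using run_start_le[of C j y] y by simp
  next
    fix y assume "y \<in> {a..b}"
    then show "y \<in> {y. y \<le> length lam \<and> run_start C j y = a}"
      using run_start_tile[OF T] b by simp
  qed
  then show ?thesis by (simp add: run_tile_def run_start_tile[OF T x] T(2))
qed

lemma covering_interval:
  assumes "x \<le> length lam" "j < K x"
  obtains T a b where "T \<in> B" "T = box lam j ` {a..b}" "a \<le> x" "x \<le> b" "b \<le> length lam"
    "ht lam a \<le> ht lam x" "b = length lam \<or> ht lam b = ht lam a"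
proof -
  obtain T where T: "T \<in> B" "box lam j x \<in> T" using box_covered[OF assms] by blast
  from tile_interval[OF T(1)] obtain a b i where i: "a \<le> b" "b \<le> length lam" "T = box lam i ` {a..b}"
    "\<forall>x\<in>{a..b}. ht lam a \<le> ht lam x" "b = length lam \<or> ht lam b = ht lam a" by blast
  have "i = j" "x \<in> {a..b}" using T(2) i(3) by auto
  then show thesis using that[of T a b] T(1) i by auto
qed

lemma tiles_of_eq: "tiles_of lam K C = B"
proof (intro set_eqI iffI)
  fix T assume "T \<in> tiles_of lam K C"
  then obtain x j where T: "T = run_tile lam C j x" "x \<le> length lam" "j < K x"
    by (auto simp: tiles_of_def)
  from covering_interval[OF T(2,3)] obtain T' a b where
    "T' \<in> B" "T' = box lam j ` {a..b}" "a \<le> x" "x \<le> b" by metis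
  then show "T \<in> B" using run_tile_eq T(1) by simp
next
  fix T assume T: "T \<in> B"
  from tile_interval[OF T] obtain a b j where ab: "a \<le> b" "T = box lam j ` {a..b}" by blast
  then have "a \<le> length lam" "j < K a" using box_in_tile[OF T, of j a] by auto
  moreover have "T = run_tile lam C j a" using run_tile_eq[OF T ab(2), of a] ab(1) by simp
  ultimately show "T \<in> tiles_of lam K C" unfolding tiles_of_def by blast
qed

lemma run_start_outside: "s \<le> length lam \<Longrightarrow> K s \<le> j \<Longrightarrow> run_start C j s = s"
proof (cases s)
  case (Suc m)
  assume "K s \<le> j"
  then have "\<not> j < C m" using connected_layers_bounds(3)[of j m] connected_layers_eq[of m] Suc by auto
  then show ?thesis using Suc by simp
qed simp

lemma run_start_ht: "s \<le> length lam \<Longrightarrow> ht lam (run_start C j s) \<le> ht lam s"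
proof (cases "j < K s")
  case True
  assume "s \<le> length lam"
  from covering_interval[OF this True] show ?thesis using run_start_tile by metis
qed (simp add: run_start_outside)

text \<open>A layer with no box in column s has only the trivial run there. Otherwise the covering
  tile must end at s, before the last column, hence at its starting height.\<close>

lemma run_end_ht:
  assumes "s < length lam" "C s \<le> j"
  shows "ht lam s = ht lam (run_start C j s)"
proof (cases "j < K s")
  case True
  from assms have "s \<le> length lam" by simp
  from covering_interval[OF this True] obtain T a b where
    T: "T \<in> B" "T = box lam j ` {a..b}" "a \<le> s" "s \<le> b" "b \<le> length lam"
    "b = length lam \<or> ht lam b = ht lam a" by metis
  have "s = b" using less_C_tile(1)[OF T(1,2,3)] T(4) assms(2) by fastforce
  then show ?thesis using T assms run_start_tile[OF T(1-4)] by simp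
qed (use assms in \<open>simp add: run_start_outside\<close>)

lemma layering: "layering lam K C"
  unfolding layering_def
proof (intro conjI allI impI)
  fix s assume s: "s < length lam"
  have len: "length mu = length lam" using above by (simp add: weakly_above_iff)
  have g: "ht mu s = ht lam s + 2 * int (K s)" "ht mu (Suc s) = ht lam (Suc s) + 2 * int (K (Suc s))"
    using ht_gap[OF above, of s] ht_gap[OF above, of "Suc s"] s by auto
  have "if lam ! s then K (Suc s) = K s \<or> Suc (K (Suc s)) = K s else K (Suc s) = K s \<or> K (Suc s) = Suc (K s)"
    using g ht_Suc[of s lam] ht_Suc[of s mu] s len by (auto split: if_splits)
  moreover have "C s \<le> K s"
    using connected_layers_bounds(2)[of "K s" s] connected_layers_eq[of s] by (metis lessThan_iff not_le less_irrefl)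
  moreover have "C s \<le> K (Suc s)"
    using connected_layers_bounds(3)[of "K (Suc s)" s] connected_layers_eq[of s] by (metis lessThan_iff not_le less_irrefl)
  ultimately show "layer_step lam K C s"
    unfolding layer_step_def using s run_start_ht[of "Suc s"] run_end_ht[OF s] by simp
qed simp

lemma path_of_eq: "path_of lam K = mu"
proof (rule nth_equalityI)
  show len: "length (path_of lam K) = length mu"
    using above by (simp add: path_of_def weakly_above_iff)
  fix s assume "s < length (path_of lam K)"
  then have s: "s < length lam" by (simp add: path_of_def)
  have g: "ht mu s = ht lam s + 2 * int (K s)" "ht mu (Suc s) = ht lam (Suc s) + 2 * int (K (Suc s))"
    using ht_gap[OF above, of s] ht_gap[OF above, of "Suc s"] s by auto
  show "path_of lam K ! s = mu ! s"
    using s len g ht_Suc[of s mu] by (simp add: path_of_def split: if_splits)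
qed

sublocale layered lam K C
  by unfold_locales (rule ballot, rule layering)

end

section \<open>The weight-preserving bijection between tilings and automaton runs\<close>

lemma run_start_cong: "(\<And>x. x < s \<Longrightarrow> C x = C' x) \<Longrightarrow> run_start C j s = run_start C' j s"
  by (induction s) auto

text \<open>Decoding an encoded pair recovers K and C only on the columns and steps of the path, so
  the constructions must be insensitive to other arguments.\<close>

lemma tiles_of_cong:
  assumes "\<And>s. s \<le> length lam \<Longrightarrow> K s = K' s" "\<And>s. s < length lam \<Longrightarrow> C s = C' s"
  shows "tiles_of lam K C = tiles_of lam K' C'"
proof -
  have "run_start C j s = run_start C' j s" if "s \<le> length lam" for j s
    using assms(2) that by (intro run_start_cong) auto
  then have "run_tile lam C j a = run_tile lam C' j a" if "a \<le> length lam" for j a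
    using that unfolding run_tile_def by (intro arg_cong[where f="(`) _"]) auto
  then show ?thesis using assms(1) unfolding tiles_of_def by metis
qed

lemma path_of_cong:
  "(\<And>s. s \<le> length lam \<Longrightarrow> K s = K' s) \<Longrightarrow> path_of lam K = path_of lam K'"
  by (simp add: path_of_def)

definition decode_K :: "(nat \<times> nat) list \<Rightarrow> nat \<Rightarrow> nat" where
  "decode_K xs s = (case s of 0 \<Rightarrow> 0 | Suc i \<Rightarrow> fst (xs ! i))"

definition decode_C :: "(nat \<times> nat) list \<Rightarrow> nat \<Rightarrow> nat" where
  "decode_C xs s = snd (xs ! s)"

lemma encode_decode: "length xs = n \<Longrightarrow> encode n (decode_K xs) (decode_C xs) = xs"
  by (rule nth_equalityI) (auto simp: encode_def decode_K_def decode_C_def)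

lemma decode_K_encode: "s \<le> n \<Longrightarrow> K 0 = 0 \<Longrightarrow> decode_K (encode n K C) s = K s"
  by (cases s) (auto simp: encode_def decode_K_def)

lemma decode_C_encode: "s < n \<Longrightarrow> decode_C (encode n K C) s = C s"
  by (auto simp: encode_def decode_C_def)

lemma encode_cong:
  "(\<And>s. s \<le> n \<Longrightarrow> K s = K' s) \<Longrightarrow> (\<And>s. s < n \<Longrightarrow> C s = C' s) \<Longrightarrow> encode n K C = encode n K' C'"
  by (simp add: encode_def)

lemma P_III_eq_wsum:
  assumes "ballot_path lam"
  shows "P_III lam q t = wsum q (\<lambda>k _. t ^ k) lam 0 [0]"
proof -
  let ?N = "length lam"
  let ?S = "{(mu, B). weakly_above mu lam \<and> ballot_tiling lam mu B \<and> cover_inclusive lam B}"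
  have tiled: "tiled lam mu B" if "(mu, B) \<in> ?S" for mu B
    using that assms by (simp add: tiled_def)
  have "(\<Sum>(mu, B)\<in>?S. q ^ art3 lam B * t ^ tiles2 lam B) =
    (\<Sum>xs\<in>{xs. config lam 0 [0] xs}. config_weight q t lam 0 xs)"
  proof (rule sum.reindex_bij_witness[
      where i="\<lambda>xs. (path_of lam (decode_K xs), tiles_of lam (decode_K xs) (decode_C xs))"
        and j="\<lambda>(mu, B). encode ?N (gap lam mu) (connectivity lam B)"])
    fix p assume p: "p \<in> ?S"
    obtain mu B where mB: "p = (mu, B)" by (cases p)
    interpret tiled lam mu B by (rule tiled) (use p mB in simp)
    let ?xs = "encode ?N K C"
    have xs: "(case p of (mu, B) \<Rightarrow> encode ?N (gap lam mu) (connectivity lam B)) = ?xs"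
      by (simp add: mB)
    have "path_of lam (decode_K ?xs) = mu"
      using path_of_cong[of lam "decode_K ?xs" K] decode_K_encode[of _ ?N K C] path_of_eq by simp
    moreover have "tiles_of lam (decode_K ?xs) (decode_C ?xs) = B"
      using tiles_of_cong[of lam "decode_K ?xs" K "decode_C ?xs" C] decode_K_encode[of _ ?N K C]
        decode_C_encode[of _ ?N K C] tiles_of_eq by simp
    ultimately show "(path_of lam (decode_K (case p of (mu, B) \<Rightarrow> encode ?N (gap lam mu) (connectivity lam B))),
        tiles_of lam (decode_K (case p of (mu, B) \<Rightarrow> encode ?N (gap lam mu) (connectivity lam B)))
          (decode_C (case p of (mu, B) \<Rightarrow> encode ?N (gap lam mu) (connectivity lam B)))) = p"
      unfolding xs by (simp add: mB)
    show "(case p of (mu, B) \<Rightarrow> encode ?N (gap lam mu) (connectivity lam B)) \<in> {xs. config lam 0 [0] xs}"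
      unfolding xs using layering layering_iff_config[OF assms] by simp
    show "config_weight q t lam 0 (case p of (mu, B) \<Rightarrow> encode ?N (gap lam mu) (connectivity lam B)) =
      (case p of (mu, B) \<Rightarrow> q ^ art3 lam B * t ^ tiles2 lam B)"
      unfolding xs using config_weight_encode[of q t lam K C] art3_tiles_of tiles2_tiles_of
      by (simp add: mB tiles_of_eq)
  next
    fix xs assume "xs \<in> {xs. config lam 0 [0] xs}"
    then have c: "config lam 0 [0] xs" by simp
    then have len: "length xs = ?N" by (rule config_length)
    have enc: "encode ?N (decode_K xs) (decode_C xs) = xs" by (rule encode_decode[OF len])
    interpret layered lam "decode_K xs" "decode_C xs"
      using assms c enc by unfold_locales (simp_all add: layering_iff_config decode_K_def)
    show "(path_of lam (decode_K xs), tiles_of lam (decode_K xs) (decode_C xs)) \<in> ?S"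
      using weakly_above_path_of tiling cover by simp
    have "encode ?N (gap lam (path_of lam (decode_K xs)))
        (connectivity lam (tiles_of lam (decode_K xs) (decode_C xs))) = encode ?N (decode_K xs) (decode_C xs)"
      by (rule encode_cong) (simp_all add: gap_path_of connectivity_def connected_layers_tiles_of)
    then show "(case (path_of lam (decode_K xs), tiles_of lam (decode_K xs) (decode_C xs)) of
        (mu, B) \<Rightarrow> encode ?N (gap lam mu) (connectivity lam B)) = xs"
      by (simp add: enc)
  qed
  then show ?thesis unfolding P_III_def sum_config by simp
qed

section \<open>Dyck tilings\<close>

lemma ht_le_end: "s \<le> length p \<Longrightarrow> ht p s \<le> ht p (length p) + int (length p - s)"
proof (induction rule: inc_induct)
  case (step s)
  then show ?case using ht_Suc[of s p] by (auto simp: of_nat_diff split: if_splits)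
qed simp

lemma height_nonneg:
  assumes "ballot_path p"
  shows "0 \<le> height p x"
proof -
  have "height p x = ht p (min (nat x) (length p))"
    by (auto simp: ht_def height_def min_def)
  then show ?thesis using assms by (simp add: ballot_path_iff)
qed

lemma dyck_path_iff: "dyck_path p \<longleftrightarrow> ballot_path p \<and> ht p (length p) = 0"
  by (simp add: dyck_path_def ht_def)

text \<open>The diagrams differ only in their bounds on the sides. A box between the paths lies
  below \<open>mu\<close>, which ends at 0 and descends by at most 1 per step; this gives the
  right-hand bound of \<open>dyckY\<close>.\<close>

lemma dyck_region_eq:
  assumes "dyck_path nu" "dyck_path mu" "weakly_above mu nu"
  shows "dyckY nu - dyckY mu = shiftedS nu - shiftedS mu"
proof (intro set_eqI iffI)
  fix p assume p: "p \<in> dyckY nu - dyckY mu"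
  obtain x b where xb: "p = (x, b)" by (cases p)
  have "0 \<le> height nu x" using assms(1) height_nonneg by (simp add: dyck_path_def)
  moreover have "length mu = length nu" using assms(3) by (simp add: weakly_above_iff)
  ultimately show "p \<in> shiftedS nu - shiftedS mu"
    using p xb by (auto simp: dyckY_def shiftedS_def)
next
  fix p assume p: "p \<in> shiftedS nu - shiftedS mu"
  obtain x b where xb: "p = (x, b)" by (cases p)
  have len: "length mu = length nu" using assms(3) by (simp add: weakly_above_iff)
  have h: "1 \<le> x" "x \<le> int (length mu)" "odd (x + b)" "height nu x \<le> b - 1" "b + 1 \<le> x"
    "\<not> height mu x \<le> b - 1"
    using p xb len by (auto simp: shiftedS_def)
  then obtain s where s: "x = int s" "s \<le> length mu"
    by (metis int_one_le_iff_zero_less nonneg_int_cases of_nat_le_iff zero_le_one order_trans)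
  have "even (ht mu s + int s)" by (rule even_ht[OF s(2)])
  then have "even (height mu x + x)" using s by (simp add: ht_def)
  then have "height mu x \<noteq> b" using h(3) by (auto simp: add.commute)
  then have "b + 1 \<le> ht mu s" using h s by (simp add: ht_def)
  also have "\<dots> \<le> int (length mu - s)"
    using ht_le_end[OF s(2)] assms(2) by (simp add: dyck_path_iff)
  finally have "b + 1 \<le> int (length nu) - x" using s len by (simp add: of_nat_diff)
  then show "p \<in> dyckY nu - dyckY mu" using h xb by (auto simp: dyckY_def)
qed

lemma finite_tilings:
  assumes "ballot_path lam"
  shows "finite {(mu, B). weakly_above mu lam \<and> ballot_tiling lam mu B \<and> cover_inclusive lam B}"
proof (rule finite_subset)
  have "shiftedS lam \<subseteq> {1..int (length lam)} \<times> {1..int (length lam)}"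
  proof (rule subrelI)
    fix x b assume "(x, b) \<in> shiftedS lam"
    then show "(x, b) \<in> {1..int (length lam)} \<times> {1..int (length lam)}"
      using height_nonneg[OF assms, of x] by (auto simp: shiftedS_def)
  qed
  then have fin: "finite (shiftedS lam)" by (rule finite_subset) simp
  show "finite ({mu. set mu \<subseteq> (UNIV :: bool set) \<and> length mu = length lam} \<times> Pow (Pow (shiftedS lam)))"
    using fin by (intro finite_cartesian_product finite_lists_length_eq) auto
  show "{(mu, B). weakly_above mu lam \<and> ballot_tiling lam mu B \<and> cover_inclusive lam B} \<subseteq>
      {mu. set mu \<subseteq> (UNIV :: bool set) \<and> length mu = length lam} \<times> Pow (Pow (shiftedS lam))"
    by (auto simp: weakly_above_def ballot_tiling_def is_partition_def)
qed

context tiled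
begin

text \<open>With no box in the last column, no tile is anchored. Every tile then has 2n + 1 boxes
  and \<open>art3_tile\<close> n + 1, so boxes plus one is twice the weight; summed over tiles this
  is \<open>art_dyck\<close>.\<close>

lemma dyck_tile_data:
  assumes "K (length lam) = 0" "T \<in> B"
  shows "dyck_tile T" "finite T" "card T + 1 = 2 * art3_tile lam T"
proof -
  from tile_interval[OF assms(2)] obtain a b j where T: "a \<le> b" "b \<le> length lam"
    "T = box lam j ` {a..b}" "\<forall>x\<in>{a..b}. ht lam a \<le> ht lam x" "b = length lam \<or> ht lam b = ht lam a"
    by blast
  have "box lam j b \<in> T" using T by auto
  then have bN: "b \<noteq> length lam" using box_in_tile(2)[OF assms(2), of j b] assms(1) by auto
  with T have eq: "ht lam b = ht lam a" by simp
  have chain: "ballot_chain (run_list lam j a b)" "set (run_list lam j a b) = T"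
    using ballot_chain_run_list[OF T(1,2)] T by (simp_all add: set_run_list)
  have snd_eq: "snd (last (run_list lam j a b)) = snd (hd (run_list lam j a b))"
    using T(1) eq by (simp add: last_run_list hd_run_list) (simp add: box_def)
  show "dyck_tile T" unfolding dyck_tile_def using chain snd_eq by blast
  show "finite T" using T by simp
  have tl: "tile_list T = run_list lam j a b" by (rule tile_list_eq[OF chain])
  have "inj_on (box lam j) {a..b}" by (auto simp: inj_on_def)
  then have card: "card T = Suc b - a" using T by (simp add: card_image)
  have "\<not> anchored lam T" using bN T(1) by (simp add: anchored_def tl last_run_list)
  moreover have "tile_rise T = 0" using snd_eq by (simp add: tile_rise_def tl)
  ultimately have art: "art3_tile lam T = nat ((int (card T) - 1) div 2) + 1"
    by (simp add: art3_tile_def tile_n_def)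
  have "even (ht lam a + int a)" "even (ht lam b + int b)" using even_ht T by auto
  then have "even (int b - int a)" using eq by auto
  then obtain k where k: "int b - int a = 2 * k" by (elim evenE)
  have "int (card T) = 2 * k + 1" using card k T(1) by (simp add: of_nat_diff)
  moreover have "0 \<le> k" using k T(1) by simp
  ultimately show "card T + 1 = 2 * art3_tile lam T" unfolding art by simp
qed

lemma art_dyck_eq:
  assumes "K (length lam) = 0"
  shows "art_dyck B = art3 lam B"
proof -
  have fin: "finite B" using tiles_of_ends finite_ends tiles_of_eq by (metis finite_imageI)
  have "card (\<Union> B) = (\<Sum>T\<in>B. card T)"
    by (rule card_Union_disjoint)
      (use disjoint dyck_tile_data(2)[OF assms] in \<open>auto simp: pairwise_def disjnt_def\<close>)
  then have "card (\<Union> B) + card B = (\<Sum>T\<in>B. card T + 1)"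
    by (simp add: sum.distrib sum_Suc)
  also have "\<dots> = (\<Sum>T\<in>B. 2 * art3_tile lam T)"
    by (intro sum.cong refl dyck_tile_data(3)[OF assms])
  also have "\<dots> = 2 * art3 lam B" by (simp add: art3_def sum_distrib_left)
  finally show ?thesis by (simp add: art_dyck_def)
qed

lemma tiles2_eq: "tiles2 lam B = K (length lam)"
  using tiles2_tiles_of tiles_of_eq by simp

end

text \<open>The anchored tiles are counted by the gap in the last column, which is 0 exactly if
  \<open>mu\<close> also ends at height 0.\<close>

lemma dyck_tiling_iff:
  assumes nu: "dyck_path nu"
  shows "dyck_path mu \<and> weakly_above mu nu \<and> dyck_tiling nu mu B \<and> cover_inclusive nu B \<longleftrightarrow>
    weakly_above mu nu \<and> ballot_tiling nu mu B \<and> cover_inclusive nu B \<and> tiles2 nu B = 0"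
proof
  assume *: "dyck_path mu \<and> weakly_above mu nu \<and> dyck_tiling nu mu B \<and> cover_inclusive nu B"
  have "ballot_tile T \<and> tile_rise T = 0" if "T \<in> B" for T
  proof -
    from * that obtain cs where cs: "ballot_chain cs" "set cs = T" "snd (last cs) = snd (hd cs)"
      by (auto simp: dyck_tiling_def dyck_tile_def)
    then show ?thesis by (auto simp: ballot_tile_def tile_rise_def tile_list_eq)
  qed
  then have tiling: "ballot_tiling nu mu B"
    using * dyck_region_eq[OF nu, of mu] by (auto simp: dyck_tiling_def ballot_tiling_def)
  interpret tiled nu mu B
    using * tiling nu by unfold_locales (auto simp: dyck_path_def)
  have "ht mu (length nu) = 0" "ht nu (length nu) = 0"
    using * nu unfolding dyck_path_iff weakly_above_iff by metis+
  then have "gap nu mu (length nu) = 0" by (simp add: gap_def)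
  then show "weakly_above mu nu \<and> ballot_tiling nu mu B \<and> cover_inclusive nu B \<and> tiles2 nu B = 0"
    using * tiling tiles2_eq by simp
next
  assume *: "weakly_above mu nu \<and> ballot_tiling nu mu B \<and> cover_inclusive nu B \<and> tiles2 nu B = 0"
  interpret tiled nu mu B
    using * nu by unfold_locales (auto simp: dyck_path_def)
  have K: "K (length nu) = 0" using tiles2_eq * by simp
  have len: "length mu = length nu" and le: "\<forall>a\<le>length nu. ht nu a \<le> ht mu a"
    using * by (auto simp: weakly_above_iff)
  have "ballot_path mu"
    using ballot len le unfolding ballot_path_iff by force
  moreover have "ht mu (length mu) = 0"
    using ht_gap[OF above, of "length nu"] K nu len by (simp add: dyck_path_iff)
  ultimately have mu: "dyck_path mu" by (simp add: dyck_path_iff)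
  have "dyck_tiling nu mu B"
    using * dyck_tile_data(1)[OF K] dyck_region_eq[OF nu mu above]
    by (auto simp: dyck_tiling_def ballot_tiling_def)
  then show "dyck_path mu \<and> weakly_above mu nu \<and> dyck_tiling nu mu B \<and> cover_inclusive nu B"
    using mu * by simp
qed

lemma P_dyck_eq_P_III:
  assumes nu: "dyck_path nu"
  shows "P_dyck nu q = P_III nu q 0"
proof -
  let ?S = "{(mu, B). weakly_above mu nu \<and> ballot_tiling nu mu B \<and> cover_inclusive nu B}"
  let ?D = "{(mu, B). dyck_path mu \<and> weakly_above mu nu \<and> dyck_tiling nu mu B \<and> cover_inclusive nu B}"
  have D: "?D = {(mu, B). weakly_above mu nu \<and> ballot_tiling nu mu B \<and> cover_inclusive nu B \<and> tiles2 nu B = 0}"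
    using dyck_tiling_iff[OF nu] by auto
  have ballot: "ballot_path nu" using nu by (simp add: dyck_path_def)
  have "P_dyck nu q = (\<Sum>(mu, B)\<in>?D. q ^ art3 nu B * 0 ^ tiles2 nu B)"
    unfolding P_dyck_def
  proof (intro sum.cong refl, clarify)
    fix mu B assume a: "dyck_path mu" "weakly_above mu nu" "dyck_tiling nu mu B" "cover_inclusive nu B"
    then have b: "weakly_above mu nu \<and> ballot_tiling nu mu B \<and> cover_inclusive nu B \<and> tiles2 nu B = 0"
      using dyck_tiling_iff[OF nu] by blast
    interpret tiled nu mu B using b ballot by unfold_locales auto
    show "q ^ art_dyck B = q ^ art3 nu B * 0 ^ tiles2 nu B"
      using art_dyck_eq b tiles2_eq by simp
  qed
  \<comment> \<open>Because 0 ^ 0 = 1, putting t = 0 keeps exactly the tilings without anchored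
    tiles.\<close>
  also have "\<dots> = (\<Sum>(mu, B)\<in>?S. q ^ art3 nu B * 0 ^ tiles2 nu B)"
  proof (rule sum.mono_neutral_left[OF finite_tilings[OF ballot]])
    show "?D \<subseteq> ?S" unfolding D by auto
    show "\<forall>p\<in>?S - ?D. (case p of (mu, B) \<Rightarrow> q ^ art3 nu B * 0 ^ tiles2 nu B) = 0"
      unfolding D by (auto simp: power_0_left split: if_split_asm)
  qed
  finally show ?thesis by (simp add: P_III_def)
qed

lemma P_III_decomp:
  assumes "ballot_path lam" "decomp q lam n d p"
  shows "P_III lam q t = p * (\<Prod>i=1..d. 1 + q ^ (i - 1) * t)"
  using P_III_eq_wsum[OF assms(1), of q t] decomp_wsum[OF assms(2), of t] by simp

lemma dyck_path_close:
  assumes "ballot_path lam"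
  shows "dyck_path (lam @ replicate (nat (ht lam (length lam))) False)"
proof -
  let ?h = "nat (ht lam (length lam))" and ?N = "length lam"
  have h: "int ?h = ht lam ?N" using assms by (simp add: ballot_path_iff)
  have rep: "s \<le> n \<Longrightarrow> ht (replicate n False) s = - int s" for s n
    by (induction s) (auto simp: ht_Suc)
  have tail: "ht (lam @ replicate ?h False) s = ht lam ?N - int (s - ?N)" if "?N \<le> s" "s \<le> ?N + ?h" for s
    using that ht_append[of lam s "replicate ?h False"] rep[of "s - ?N" ?h] by simp
  have "0 \<le> ht (lam @ replicate ?h False) s" if "s \<le> ?N + ?h" for s
  proof (cases "s \<le> ?N")
    case True
    then show ?thesis using assms by (simp add: ht_append1 ballot_path_iff)
  next
    case False
    then have "int (s - ?N) \<le> int ?h" using that by linarith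
    then have "int (s - ?N) \<le> ht lam ?N" by (simp only: h)
    then show ?thesis using tail[of s] False that by linarith
  qed
  then show ?thesis
    unfolding dyck_path_iff ballot_path_iff using tail[of "?N + ?h"] h by simp
qed

theorem mainTheorem3:
  fixes lam :: "bool list" and q t :: "'a::comm_ring_1"
  assumes "ballot_path lam"
  shows "P_III lam q t =
    P_dyck (lam @ replicate (nat (height lam (int (length lam)))) False) q *
    (\<Prod>i=1..num_D lam. (1 + q ^ (i - 1) * t))"
proof -
  obtain n d p where dec: "decomp q lam n d p" using ballot_decomp[OF assms] by blast
  have d: "num_D lam = d" "length lam = n + d" using decomp_counts[OF dec] by auto
  let ?nu = "lam @ replicate (nat (ht lam (length lam))) False"
  have "nat (ht lam (length lam)) = n - d" using ht_length[of lam] d decomp_le[OF dec] by simp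
  then have "decomp q ?nu n n p" using decomp_close[OF dec] by simp
  moreover have nu: "dyck_path ?nu" by (rule dyck_path_close[OF assms])
  \<comment> \<open>At t = 0 every factor of the product is 1, so the closed path yields the
    constant p, shared with \<open>lam\<close>.\<close>
  ultimately have "P_dyck ?nu q = p"
    using P_dyck_eq_P_III[OF nu, of q] P_III_decomp[of ?nu q n n p 0] by (simp add: dyck_path_def)
  then show ?thesis using P_III_decomp[OF assms dec] d by (simp add: ht_def)
qed

end
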